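(* Let $m\in\mathbb{N}$, let $\alpha>\beta\ge 0$ and let $\mathbf{b}=(b_j)_{j\in\mathbb{N}}$ be a positive sequence. Put $a:=\alpha-\beta>0$ and suppose that $$\begin{cases}\|\mathbf{b}\|_{\ell_1(\mathbb{N})}<1 \ \text{ and }\ \mathbf{b}\in\ell_{m/a}(\mathbb{N}), & \text{if } m/a\le 1,\\ \|\mathbf{b}\|_{\ell_1(\mathbb{N})}\le 1, & \text{if } m/a>1.\end{cases}$$ Let $T\ge1$, $E(T):=E_{\alpha-\beta,\mathbf{b}}(T)$ and $n:=|E(T)|$. Then $$d_n(U^{\alpha,\mathbf{b}},K^\beta)\le\sup_{v\in U^{\alpha,\mathbf{b}}}\inf_{g\in\mathcal{V}(E(T))}\|v-g\|_{K^\beta}=\sup_{v\in U^{\alpha,\mathbf{b}}}\|v-\mathcal{S}_{E(T)}(v)\|_{K^\beta}\le 2^{\alpha-\beta}C^{(\alpha-\beta)/m}\,n^{-(\alpha-\beta)/m},$$ and for every $s\in\mathbb{N}$, $$d_n(U_s^{\alpha,\mathbf{b}},K_s^\beta)\le\sup_{v\in U_s^{\alpha,\mathbf{b}}}\inf_{g\in\mathcal{V}_s(E(T))}\|v-g\|_{K_s^\beta}=\sup_{v\in U_s^{\alpha,\mathbf{b}}}\|v-\mathcal{S}_{s,E(T)}(v)\|_{K_s^\beta}\le 2^{\alpha-\beta}C^{(\alpha-\beta)/m}\,n^{-(\alpha-\beta)/m},$$ where $$C:=\left(\tfrac32\right)^{2m}\sum_{\mathbf{s}\in\mathbb{F}}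\left(\frac{|\mathbf{s}|_1!}{\mathbf{s}!}\,\mathbf{b}^{\mathbf{s}}\right)^{m/(\alpha-\beta)}.$$
   Context: Index sets. $\mathbb{F}$ is the set of all sequences $\mathbf{s}=(s_j)_{j=1}^\infty$ of nonnegative integers with finite support $\operatorname{supp}(\mathbf{s})$; $\mathbf{s}!:=\prod_j s_j!$, $|\mathbf{s}|_1:=\sum_j s_j$, $\mathbf{b}^{\mathbf{s}}:=\prod_j b_j^{s_j}$, $\mathbf{b}^{-\mathbf{s}}:=\prod_j b_j^{-s_j}$. $\mathbb{Z}^m_*:=\{\mathbf{k}\in\mathbb{Z}^m:k_j\ne0,\ j=1,\dots,m\}$, $|\mathbf{k}|_\infty:=\max_j|k_j|$. For $a>0$ and $(\mathbf{k},\mathbf{s})\in\mathbb{Z}^m_*\times\mathbb{F}$ put $\rho_{a,\mathbf{b}}(\mathbf{k},\mathbf{s}):=|\mathbf{k}|_\infty^{a}\frac{\mathbf{s}!}{|\mathbf{s}|_1!}\mathbf{b}^{-\mathbf{s}}$, and for $T>0$ put $E_{a,\mathbf{b}}(T):=\{(\mathbf{k},\mathbf{s})\in\mathbb{Z}^m_*\times\mathbb{F}:\rho_{a,\mathbf{b}}(\mathbf{k},\mathbf{s})\le T\}$; $|E|$ is cardinality. Function spaces. $\mathbb{T}^m$ is the $m$-dimensional torus (period $1$ in each variable) with normalized Lebesgue measure; $\mathbb{I}=[-1,1]$; $\mathbb{I}^\infty$ is the set of sequences with entries in $\mathbb{I}$, equipped with the infinite product $\mu$ of the uniform probability measures $\frac12\,dy_j$.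 $L_2(\mathbb{T}^m\times\mathbb{I}^\infty):=L_2(\mathbb{T}^m)\otimes L_2(\mathbb{I}^\infty,\mu)$. Put $L_{(\mathbf{k},\mathbf{s})}(\mathbf{x},\mathbf{y}):=e_{\mathbf{k}}(\mathbf{x})L_{\mathbf{s}}(\mathbf{y})$ with $e_{\mathbf{k}}(\mathbf{x})=\prod_{j=1}^m e^{2\pi i k_jx_j}$ and $L_{\mathbf{s}}(\mathbf{y})=\prod_{j\in\operatorname{supp}(\mathbf{s})}L_{s_j}(y_j)$, where $L_0,L_1,\dots$ are the univariate Legendre polynomials, orthonormal in $L_2(\mathbb{I},\frac12 dy)$; $\{L_{(\mathbf{k},\mathbf{s})}\}_{(\mathbf{k},\mathbf{s})\in\mathbb{Z}^m\times\mathbb{F}}$ is an orthonormal basis of $L_2(\mathbb{T}^m\times\mathbb{I}^\infty)$, and $v_{\mathbf{k},\mathbf{s}}:=\langle v,L_{(\mathbf{k},\mathbf{s})}\rangle$. The space $A^{\alpha,\mathbf{b}}$ consists of all $v\in L_2(\mathbb{T}^m\times\mathbb{I}^\infty)$ of the form $v=\sum_{(\mathbf{k},\mathbf{s})\in\mathbb{Z}^m_*\times\mathbb{F}}v_{\mathbf{k},\mathbf{s}}L_{(\mathbf{k},\mathbf{s})}$ with $\|v\|_{A^{\alpha,\mathbf{b}}}^2:=\sum_{(\mathbf{k},\mathbf{s})\in\mathbb{Z}^m_*\times\mathbb{F}}\rho_{\alpha,\mathbf{b}}(\mathbf{k},\mathbf{s})^2|v_{\mathbf{k},\mathbf{s}}|^2<\infty$.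 The space $K^\beta$ consists of all $v\in L_2(\mathbb{T}^m\times\mathbb{I}^\infty)$ of the same form with $\|v\|_{K^\beta}^2:=\sum_{(\mathbf{k},\mathbf{s})\in\mathbb{Z}^m_*\times\mathbb{F}}|\mathbf{k}|_\infty^{2\beta}|v_{\mathbf{k},\mathbf{s}}|^2<\infty$. For a finite set $G\subset\mathbb{Z}^m_*\times\mathbb{F}$, $\mathcal{V}(G)$ is the linear span of $\{L_{(\mathbf{k},\mathbf{s})}:(\mathbf{k},\mathbf{s})\in G\}$ and $\mathcal{S}_Gv:=\sum_{(\mathbf{k},\mathbf{s})\in G}v_{\mathbf{k},\mathbf{s}}L_{(\mathbf{k},\mathbf{s})}$ for $v\in L_2(\mathbb{T}^m\times\mathbb{I}^\infty)$. For $s\in\mathbb{N}$, $L_2(\mathbb{T}^m\times\mathbb{I}^s)$ is regarded as the subspace of $L_2(\mathbb{T}^m\times\mathbb{I}^\infty)$ of functions depending only on $\mathbf{x},y_1,\dots,y_s$; $A_s^{\alpha,\mathbf{b}}$, $K_s^\beta$, $\mathcal{V}_s(G)$ are the intersections of $A^{\alpha,\mathbf{b}}$, $K^\beta$, $\mathcal{V}(G)$ with $L_2(\mathbb{T}^m\times\mathbb{I}^s)$ (with the inherited norms), and $\mathcal{S}_{s,G}$ is the restriction of $\mathcal{S}_G$ to $L_2(\mathbb{T}^m\times\mathbb{I}^s)$. $U^{\alpha,\mathbf{b}}$ and $U_s^{\alpha,\mathbf{b}}$ are the unit balls $\{\|v\|\le1\}$ of $A^{\alpha,\mathbf{b}}$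 and $A_s^{\alpha,\mathbf{b}}$. Kolmogorov $n$-width. For a Hilbert space $X$ and $W\subset X$, $d_n(W,X):=\inf_{M_n}\sup_{w\in W}\inf_{v\in M_n}\|w-v\|_X$, the outer infimum being over all linear manifolds (linear subspaces) $M_n$ of $X$ of dimension at most $n$. *)

theory Defs
  imports
    "HOL-Probability.Probability"
    "HOL-Computational_Algebra.Polynomial"
    "HOL-Library.Function_Algebras"
begin

text \<open>
  Sequences indexed by 1, 2, 3, ... are functions on \<^typ>\<open>nat\<close> shifted to start at 0. Vectors with
  \<open>m\<close> entries are functions on \<^typ>\<open>nat\<close> that are extensional on \<open>{..<m}\<close>.
\<close>

section \<open>Index sets\<close>

definition supp :: "(nat \<Rightarrow> nat) \<Rightarrow> nat set" where
  "supp s = {j. s j \<noteq> 0}"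

definition Fseq :: "(nat \<Rightarrow> nat) set" where
  "Fseq = {s. finite (supp s)}"

text \<open>All factors (summands) off the support are 1 (0), so the infinite products and sums over
  \<open>j\<close> reduce to the support.\<close>

definition sfact :: "(nat \<Rightarrow> nat) \<Rightarrow> real" where
  "sfact s = (\<Prod>j\<in>supp s. fact (s j))"

definition snorm1 :: "(nat \<Rightarrow> nat) \<Rightarrow> nat" where
  "snorm1 s = (\<Sum>j\<in>supp s. s j)"

definition spow :: "(nat \<Rightarrow> real) \<Rightarrow> (nat \<Rightarrow> nat) \<Rightarrow> real" where
  "spow b s = (\<Prod>j\<in>supp s. b j ^ s j)"

definition spow_neg :: "(nat \<Rightarrow> real) \<Rightarrow> (nat \<Rightarrow> nat) \<Rightarrow> real" where
  "spow_neg b s = (\<Prod>j\<in>supp s. b j powi (- int (s j)))"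

definition Zstar :: "nat \<Rightarrow> (nat \<Rightarrow> int) set" where
  "Zstar m = {..<m} \<rightarrow>\<^sub>E {i. i \<noteq> 0}"

definition knorm :: "nat \<Rightarrow> (nat \<Rightarrow> int) \<Rightarrow> int" where
  "knorm m k = Max ((\<lambda>j. \<bar>k j\<bar>) ` {..<m})"

definition rho :: "nat \<Rightarrow> real \<Rightarrow> (nat \<Rightarrow> real) \<Rightarrow> (nat \<Rightarrow> int) \<times> (nat \<Rightarrow> nat) \<Rightarrow> real" where
  "rho m a b = (\<lambda>(k, s).
     real_of_int (knorm m k) powr a * (sfact s / fact (snorm1 s)) * spow_neg b s)"

definition Eset :: "nat \<Rightarrow> real \<Rightarrow> (nat \<Rightarrow> real) \<Rightarrow> real \<Rightarrow> ((nat \<Rightarrow> int) \<times> (nat \<Rightarrow> nat)) set" where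
  "Eset m a b T = {ks \<in> Zstar m \<times> Fseq. rho m a b ks \<le> T}"

section \<open>Square integrable functions on the torus times the infinite cube\<close>

text \<open>The torus is represented by the fundamental domain \<open>[0,1)\<close> in each variable.\<close>

definition torus :: "nat \<Rightarrow> (nat \<Rightarrow> real) measure" where
  "torus m = Pi\<^sub>M {..<m} (\<lambda>_. restrict_space lborel {0..<1})"

definition cube :: "(nat \<Rightarrow> real) measure" where
  "cube = Pi\<^sub>M UNIV (\<lambda>_. uniform_measure (restrict_space lborel {-1..1}) {-1..1})"

definition TI :: "nat \<Rightarrow> ((nat \<Rightarrow> real) \<times> (nat \<Rightarrow> real)) measure" where
  "TI m = torus m \<Otimes>\<^sub>M cube"

type_synonym tifun = "(nat \<Rightarrow> real) \<times> (nat \<Rightarrow> real) \<Rightarrow> complex"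

text \<open>Elements of \<open>L2\<close> are functions rather than classes of functions modulo null sets. Among
  measurable functions, all the spaces below except the spans are closed under almost everywhere
  equality, and the coefficients, and hence all norms, depend only on the class.\<close>

definition L2 :: "nat \<Rightarrow> tifun set" where
  "L2 m = {v \<in> borel_measurable (TI m). integrable (TI m) (\<lambda>z. (cmod (v z))\<^sup>2)}"

definition L2_norm :: "nat \<Rightarrow> tifun \<Rightarrow> real" where
  "L2_norm m v = sqrt (LINT z|TI m. (cmod (v z))\<^sup>2)"

text \<open>The subspace of (classes of) functions that depend only on \<open>x\<close> and the first \<open>s\<close> of the
  variables \<open>y\<close>.\<close>

definition L2_fin :: "nat \<Rightarrow> nat \<Rightarrow> tifun set" where
  "L2_fin m s = {v \<in> L2 m. \<exists>w \<in> L2 m. (AE z in TI m. v z = w z) \<and>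
     (\<forall>x \<in> space (torus m). \<forall>y \<in> space cube. \<forall>y' \<in> space cube.
        (\<forall>j<s. y j = y' j) \<longrightarrow> w (x, y) = w (x, y'))}"

text \<open>Rodrigues' formula \<open>P\<^sub>n(t) = 1 / (2^n n!) (d/dt)^n (t^2 - 1)^n\<close> for the Legendre polynomials;
  the factor \<open>sqrt (2 n + 1)\<close> normalises them with respect to \<open>dt / 2\<close> on \<open>[-1,1]\<close>.\<close>

definition legendre :: "nat \<Rightarrow> real poly" where
  "legendre n = smult (sqrt (2 * real n + 1) / (2 ^ n * fact n)) ((pderiv ^^ n) ([:-1, 0, 1:] ^ n))"

definition efun :: "nat \<Rightarrow> (nat \<Rightarrow> int) \<Rightarrow> (nat \<Rightarrow> real) \<Rightarrow> complex" where
  "efun m k x = (\<Prod>j<m. exp (2 * of_real pi * \<i> * of_int (k j) * of_real (x j)))"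

definition Lpoly :: "(nat \<Rightarrow> nat) \<Rightarrow> (nat \<Rightarrow> real) \<Rightarrow> real" where
  "Lpoly s y = (\<Prod>j\<in>supp s. poly (legendre (s j)) (y j))"

definition Lfun :: "nat \<Rightarrow> (nat \<Rightarrow> int) \<times> (nat \<Rightarrow> nat) \<Rightarrow> tifun" where
  "Lfun m = (\<lambda>(k, s) (x, y). efun m k x * of_real (Lpoly s y))"

definition coef :: "nat \<Rightarrow> tifun \<Rightarrow> (nat \<Rightarrow> int) \<times> (nat \<Rightarrow> nat) \<Rightarrow> complex" where
  "coef m v ks = (LINT z|TI m. v z * cnj (Lfun m ks z))"

definition Sop :: "nat \<Rightarrow> ((nat \<Rightarrow> int) \<times> (nat \<Rightarrow> nat)) set \<Rightarrow> tifun \<Rightarrow> tifun" where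
  "Sop m G v = (\<lambda>z. \<Sum>ks\<in>G. coef m v ks * Lfun m ks z)"

text \<open>\<open>v\<close> is the sum in \<open>L2\<close> of the orthogonal series of the \<open>v\<^sub>k\<^sub>s L\<^sub>k\<^sub>s\<close> over all \<open>k\<close> in \<open>Zstar m\<close>
  and \<open>s\<close> in \<open>Fseq\<close>, i.e. the net of finite partial sums converges to \<open>v\<close>.\<close>

definition is_Lseries :: "nat \<Rightarrow> tifun \<Rightarrow> bool" where
  "is_Lseries m v \<longleftrightarrow>
     ((\<lambda>G. L2_norm m (v - Sop m G v)) \<longlongrightarrow> 0) (finite_subsets_at_top (Zstar m \<times> Fseq))"

section \<open>The spaces \<open>A\<close> and \<open>K\<close>\<close>

definition A_space :: "nat \<Rightarrow> real \<Rightarrow> (nat \<Rightarrow> real) \<Rightarrow> tifun set" where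
  "A_space m \<alpha> b = {v \<in> L2 m. is_Lseries m v \<and>
     (\<lambda>ks. (rho m \<alpha> b ks)\<^sup>2 * (cmod (coef m v ks))\<^sup>2) summable_on (Zstar m \<times> Fseq)}"

definition A_norm :: "nat \<Rightarrow> real \<Rightarrow> (nat \<Rightarrow> real) \<Rightarrow> tifun \<Rightarrow> real" where
  "A_norm m \<alpha> b v =
     sqrt (\<Sum>\<^sub>\<infinity>ks \<in> Zstar m \<times> Fseq. (rho m \<alpha> b ks)\<^sup>2 * (cmod (coef m v ks))\<^sup>2)"

definition K_space :: "nat \<Rightarrow> real \<Rightarrow> tifun set" where
  "K_space m \<beta> = {v \<in> L2 m. is_Lseries m v \<and>
     (\<lambda>(k, s). real_of_int (knorm m k) powr (2 * \<beta>) * (cmod (coef m v (k, s)))\<^sup>2)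
       summable_on (Zstar m \<times> Fseq)}"

definition K_norm :: "nat \<Rightarrow> real \<Rightarrow> tifun \<Rightarrow> real" where
  "K_norm m \<beta> v =
     sqrt (\<Sum>\<^sub>\<infinity>(k, s) \<in> Zstar m \<times> Fseq.
       real_of_int (knorm m k) powr (2 * \<beta>) * (cmod (coef m v (k, s)))\<^sup>2)"

definition U_ball :: "nat \<Rightarrow> real \<Rightarrow> (nat \<Rightarrow> real) \<Rightarrow> tifun set" where
  "U_ball m \<alpha> b = {v \<in> A_space m \<alpha> b. A_norm m \<alpha> b v \<le> 1}"

section \<open>Complex spans and Kolmogorov widths\<close>

definition fun_scale :: "complex \<Rightarrow> ('a \<Rightarrow> complex) \<Rightarrow> 'a \<Rightarrow> complex" where
  "fun_scale c f = (\<lambda>z. c * f z)"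

interpretation cfun: vector_space fun_scale
  by unfold_locales (auto simp: fun_scale_def algebra_simps)

definition Vspan :: "nat \<Rightarrow> ((nat \<Rightarrow> int) \<times> (nat \<Rightarrow> nat)) set \<Rightarrow> tifun set" where
  "Vspan m G = cfun.span (Lfun m ` G)"

definition A_space_fin :: "nat \<Rightarrow> real \<Rightarrow> (nat \<Rightarrow> real) \<Rightarrow> nat \<Rightarrow> tifun set" where
  "A_space_fin m \<alpha> b s = A_space m \<alpha> b \<inter> L2_fin m s"

definition K_space_fin :: "nat \<Rightarrow> real \<Rightarrow> nat \<Rightarrow> tifun set" where
  "K_space_fin m \<beta> s = K_space m \<beta> \<inter> L2_fin m s"

definition Vspan_fin :: "nat \<Rightarrow> ((nat \<Rightarrow> int) \<times> (nat \<Rightarrow> nat)) set \<Rightarrow> nat \<Rightarrow> tifun set" where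
  "Vspan_fin m G s = Vspan m G \<inter> L2_fin m s"

definition U_ball_fin :: "nat \<Rightarrow> real \<Rightarrow> (nat \<Rightarrow> real) \<Rightarrow> nat \<Rightarrow> tifun set" where
  "U_ball_fin m \<alpha> b s = {v \<in> A_space_fin m \<alpha> b s. A_norm m \<alpha> b v \<le> 1}"

text \<open>A finite basis is demanded explicitly because \<open>dim\<close> is 0 on infinite-dimensional spaces.\<close>

definition dim_at_most :: "nat \<Rightarrow> ('a \<Rightarrow> complex) set \<Rightarrow> bool" where
  "dim_at_most n M \<longleftrightarrow>
     (\<exists>B. finite B \<and> card B \<le> n \<and> \<not> cfun.dependent B \<and> cfun.span B = M)"

text \<open>The \<open>n\<close>-width of \<open>W\<close> in the space \<open>X\<close> with norm \<open>N\<close>, with values in \<open>[0,\<infinity>]\<close>. If \<open>X\<close> consists of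
  functions standing for their classes modulo null functions, then passing to classes does not raise
  the dimension of \<open>M\<close>, and every space of classes of dimension at most \<open>n\<close> is the image of a space of
  representatives of the same dimension; so the infimum is the one over subspaces of the quotient.\<close>

definition kolmogorov_width ::
  "nat \<Rightarrow> ('a \<Rightarrow> complex) set \<Rightarrow> ('a \<Rightarrow> complex) set \<Rightarrow> (('a \<Rightarrow> complex) \<Rightarrow> real) \<Rightarrow> ennreal" where
  "kolmogorov_width n W X N =
     (INF M \<in> {M. cfun.subspace M \<and> M \<subseteq> X \<and> dim_at_most n M}.
        SUP w \<in> W. INF v \<in> M. ennreal (N (w - v)))"

section \<open>The constant\<close>

definition width_term :: "nat \<Rightarrow> real \<Rightarrow> (nat \<Rightarrow> real) \<Rightarrow> (nat \<Rightarrow> nat) \<Rightarrow> real" where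
  "width_term m a b s = (fact (snorm1 s) / sfact s * spow b s) powr (real m / a)"

definition width_const :: "nat \<Rightarrow> real \<Rightarrow> (nat \<Rightarrow> real) \<Rightarrow> real" where
  "width_const m a b = (3 / 2) ^ (2 * m) * (\<Sum>\<^sub>\<infinity>s\<in>Fseq. width_term m a b s)"

end

theory Submission
  imports Defs
begin

text \<open>
  The estimate compares two weights. At the index \<open>(k, s)\<close> the squared norm of \<open>K\<close> has the weight
  \<open>\<bar>k\<bar>^(2 \<beta>)\<close>, and that of \<open>A\<close> has the square of \<open>\<rho>\<^sub>\<alpha> = \<bar>k\<bar>^\<beta> \<rho>\<^sub>a\<close> with \<open>a = \<alpha> - \<beta>\<close>. Off \<open>E(T)\<close> one
  has \<open>\<rho>\<^sub>a > T\<close>, so for \<open>v\<close> in the unit ball of \<open>A\<close> the part of the series off \<open>E(T)\<close> has norm at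
  most \<open>1 / T\<close> in \<open>K\<close> (\<open>K_norm_remainder_le\<close>). By orthonormality a function in the span of
  \<open>E(T)\<close> changes only the coefficients on \<open>E(T)\<close>, so the partial sum is the best approximation
  (\<open>K_norm_Sop_le\<close>), and the span, whose dimension is at most \<open>n\<close>, competes in the width.

  It remains to bound \<open>1 / T\<close> by a power of \<open>n\<close>. Put \<open>x\<^sub>s = \<bar>s\<bar>! / s! b^s\<close>. Then \<open>(k, s)\<close> lies in \<open>E(T)\<close>
  iff \<open>\<bar>k\<bar> \<le> R\<close> with \<open>R = (T x\<^sub>s)^(1/a)\<close>, which leaves at most \<open>(2 R)^m\<close> choices of \<open>k\<close>. Summing over
  \<open>s\<close> gives \<open>n \<le> 2^m T^(m/a) \<Sum>\<^sub>s x\<^sub>s^(m/a)\<close> (\<open>card_Eset_le\<close>), and this is solved for \<open>1 / T\<close>.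

  The analytic core is the convergence of \<open>\<Sum>\<^sub>s x\<^sub>s^p\<close> for \<open>p = m / a\<close>. The sum of \<open>x\<^sub>s\<close> over the level
  \<open>\<bar>s\<bar> = n\<close> is at most \<open>(\<Sum>\<^sub>j b\<^sub>j)^n\<close> by the multinomial theorem.

  \<^item> For \<open>p \<le> 1\<close> finitely many coordinates are split off. A single term of a binomial expansion bounds
    the binomial coefficient that couples the two parts. The finite part is then dominated by a
    product of geometric series because \<open>\<Sum>\<^sub>j b\<^sub>j < 1\<close>, and for the rest the multinomial theorem is
    applied to the sequence \<open>b\<^sub>j^p\<close>, whose tails are small
    (\<open>multinomial_term_summable_subcritical\<close>).

  \<^item> For \<open>p > 1\<close> the level sums may all be equal to 1, and the gain has to come from the size of the
    single terms. A multinomial term is, up to the factor \<open>n! e^n / n^n\<close>, a product of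
    Poisson weights, each of which decays like a negative power of \<open>s\<^sub>j + 1\<close>. All \<open>b\<^sub>j\<close> are positive,
    so arbitrarily many coordinates can contribute such a power. The average of
    their product over a level is controlled by raising these coordinates by one, which carries the
    level \<open>n\<close> into the level \<open>n + d\<close> (\<open>multinomial_term_summable_supercritical\<close>).

  Orthonormality of the Legendre polynomials follows from Rodrigues' formula by repeated integration
  by parts. On the infinite cube everything is reduced to one variable by integrating over
  one coordinate at a time (\<open>cube_integral_split\<close>). The same device shows that a function of
  \<open>x, y\<^sub>1, ..., y\<^sub>r\<close> has zero coefficients at all \<open>s\<close> that involve later coordinates, so its partial
  sums again depend only on \<open>x, y\<^sub>1, ..., y\<^sub>r\<close>. This gives the estimates for
  finitely many variables.
\<close>

section \<open>Multinomial terms and their sums over the levels\<close>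

text \<open>The term of index \<open>s\<close> in the multinomial expansion of \<open>(\<Sum>j. b j) ^ snorm1 s\<close>. It is the reciprocal
  of the factor of \<open>rho\<close> that depends on \<open>s\<close>, and its powers are the terms of the series in
  \<open>width_const\<close>.\<close>

definition multinomial_term :: "(nat \<Rightarrow> real) \<Rightarrow> (nat \<Rightarrow> nat) \<Rightarrow> real" where
  "multinomial_term b s = fact (snorm1 s) / sfact s * spow b s"

lemma Fseq_iff: "s \<in> Fseq \<longleftrightarrow> finite (supp s)"
  by (simp add: Fseq_def)

lemma supp_update_subset: "supp (s(j := k)) \<subseteq> insert j (supp s)"
  by (auto simp: supp_def)

lemma Fseq_update: "s \<in> Fseq \<Longrightarrow> s(j := k) \<in> Fseq"
  using finite_subset[OF supp_update_subset] by (simp add: Fseq_iff)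

lemma snorm1_eq_sum:
  assumes "finite A" "supp s \<subseteq> A"
  shows "snorm1 s = (\<Sum>j\<in>A. s j)"
  unfolding snorm1_def using assms by (intro sum.mono_neutral_left) (auto simp: supp_def)

lemma sfact_eq_prod:
  assumes "finite A" "supp s \<subseteq> A"
  shows "sfact s = (\<Prod>j\<in>A. fact (s j))"
  unfolding sfact_def using assms by (intro prod.mono_neutral_left) (auto simp: supp_def)

lemma spow_eq_prod:
  assumes "finite A" "supp s \<subseteq> A"
  shows "spow b s = (\<Prod>j\<in>A. b j ^ s j)"
  unfolding spow_def using assms by (intro prod.mono_neutral_left) (auto simp: supp_def)

lemma sfact_pos: "sfact s > 0"
  unfolding sfact_def by (intro prod_pos) auto

lemma multinomial_term_eq:
  assumes "finite A" "supp s \<subseteq> A"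
  shows "multinomial_term b s = fact (snorm1 s) * (\<Prod>j\<in>A. b j ^ s j / fact (s j))"
  using assms
  by (simp add: multinomial_term_def sfact_eq_prod spow_eq_prod prod_dividef)

lemma multinomial_term_nonneg: "(\<And>j. 0 \<le> b j) \<Longrightarrow> 0 \<le> multinomial_term b s"
  unfolding multinomial_term_def spow_def
  by (intro mult_nonneg_nonneg divide_nonneg_nonneg prod_nonneg) (auto simp: less_imp_le sfact_pos)

lemma multinomial_term_pos: "(\<And>j. 0 < b j) \<Longrightarrow> 0 < multinomial_term b s"
  unfolding multinomial_term_def spow_def
  by (intro mult_pos_pos divide_pos_pos prod_pos) (auto simp: sfact_pos)

lemma snorm1_decrement:
  assumes "s \<in> Fseq" "j \<in> supp s"
  shows "Suc (snorm1 (s(j := s j - 1))) = snorm1 s"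
proof -
  have fin: "finite (supp s)" using assms by (simp add: Fseq_iff)
  have sub: "supp (s(j := s j - 1)) \<subseteq> supp s"
    using assms(2) by (auto simp: supp_def)
  have pos: "s j > 0" using assms(2) by (simp add: supp_def)
  have "snorm1 (s(j := s j - 1)) = (\<Sum>i\<in>supp s. (s(j := s j - 1)) i)"
    by (rule snorm1_eq_sum[OF fin sub])
  also have "\<dots> = (s j - 1) + (\<Sum>i\<in>supp s - {j}. s i)"
    using fin assms(2) by (simp add: sum.remove[of _ j])
  finally show ?thesis
    using fin assms(2) pos by (simp add: snorm1_def sum.remove[of _ j])
qed

text \<open>Pascal's rule for multinomial coefficients, with the powers of \<open>b\<close> attached: lowering the entry \<open>s j\<close>
  multiplies the term by \<open>s j / snorm1 s\<close>, apart from the factor \<open>b j\<close>, and these fractions add up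
  to 1.\<close>

lemma multinomial_term_recurrence:
  assumes s: "s \<in> Fseq" and n: "snorm1 s = Suc n"
  shows "multinomial_term b s = (\<Sum>j\<in>supp s. b j * multinomial_term b (s(j := s j - 1)))"
proof -
  have fin: "finite (supp s)" using s by (simp add: Fseq_iff)
  define P where "P = (\<Prod>j\<in>supp s. b j ^ s j / fact (s j))"
  have "b j * multinomial_term b (s(j := s j - 1)) = fact n * real (s j) * P"
    if j: "j \<in> supp s" for j
  proof -
    let ?t = "s(j := s j - 1)"
    obtain r where r: "s j = Suc r" using j by (auto simp: supp_def gr0_conv_Suc)
    have sub: "supp ?t \<subseteq> supp s" using j by (auto simp: supp_def)
    have norm: "snorm1 ?t = n" using snorm1_decrement[OF s j] n by simp
    define Q where "Q = (\<Prod>i\<in>supp s - {j}. b i ^ s i / fact (s i))"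
    have "(\<Prod>i\<in>supp s. b i ^ ?t i / fact (?t i)) = b j ^ r / fact r * Q"
      using fin j r by (simp add: Q_def prod.remove[of _ j])
    then have t: "multinomial_term b ?t = fact n * (b j ^ r / fact r * Q)"
      using multinomial_term_eq[OF fin sub, of b] norm by simp
    have P: "P = b j ^ Suc r / fact (Suc r) * Q"
      unfolding P_def Q_def using fin j r by (simp add: prod.remove[of _ j])
    have "b j ^ Suc r / fact (Suc r) * real (Suc r) = b j * b j ^ r / fact r"
      by (simp add: fact_Suc del: of_nat_Suc)
    moreover have "fact n * real (Suc r) * P
        = fact n * (b j ^ Suc r / fact (Suc r) * real (Suc r)) * Q"
      unfolding P by (simp only: mult.assoc mult.commute mult.left_commute)
    ultimately show ?thesis
      using t by (simp add: r)
  qed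
  then have "(\<Sum>j\<in>supp s. b j * multinomial_term b (s(j := s j - 1)))
      = fact n * real (snorm1 s) * P"
    by (simp add: snorm1_def sum_distrib_left sum_distrib_right)
  also have "\<dots> = multinomial_term b s"
    using multinomial_term_eq[OF fin order_refl, of b] n by (simp add: P_def)
  finally show ?thesis ..
qed

text \<open>The inequality in the multinomial theorem that survives for infinitely many variables. By the
  recurrence the sum over \<open>F\<close> runs over pairs \<open>(s, j)\<close>, and \<open>(s, j) \<mapsto> (s - e\<^sub>j, j)\<close> is injective, so
  each level contributes one factor \<open>\<Sum>j. b j\<close>.\<close>

lemma sum_multinomial_term_le:
  assumes b: "\<And>j. 0 \<le> b j" "summable b"
    and F: "finite F" "F \<subseteq> {s \<in> Fseq. snorm1 s = n}"
  shows "(\<Sum>s\<in>F. multinomial_term b s) \<le> suminf b ^ n"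
  using F
proof (induction n arbitrary: F)
  case 0
  have "F \<subseteq> {\<lambda>_. 0}"
  proof
    fix s assume "s \<in> F"
    then have "s \<in> Fseq" "snorm1 s = 0" using 0 by auto
    then have "\<forall>j\<in>supp s. s j = 0" by (simp add: snorm1_def Fseq_iff)
    then show "s \<in> {\<lambda>_. 0}" by (auto simp: supp_def)
  qed
  moreover have "multinomial_term b (\<lambda>_. 0) = 1"
    by (simp add: multinomial_term_def sfact_def spow_def snorm1_def supp_def)
  moreover have "F = {} \<or> F = {\<lambda>_. 0}"
    using calculation(1) by (rule subset_singletonD)
  ultimately show ?case by (elim disjE) simp_all
next
  case (Suc n)
  define D where "D = (SIGMA s:F. supp s)"
  define h where "h = (\<lambda>(s::nat \<Rightarrow> nat, j). (s(j := s j - 1), j))"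
  define F' where "F' = (\<lambda>(s, j). s(j := s j - 1)) ` D"
  define A where "A = (\<Union>s\<in>F. supp s)"
  have Fs: "s \<in> Fseq" "finite (supp s)" "snorm1 s = Suc n" if "s \<in> F" for s
    using that Suc.prems by (auto simp: Fseq_iff)
  have finD: "finite D" and finA: "finite A" and finF': "finite F'"
    using Suc.prems(1) Fs by (auto simp: D_def A_def F'_def)
  have inj: "inj_on h D"
  proof (rule inj_onI)
    fix u v assume uv: "u \<in> D" "v \<in> D" "h u = h v"
    obtain s j where u: "u = (s, j)" by (cases u)
    obtain t i where v: "v = (t, i)" by (cases v)
    have ij: "i = j" and eq: "s(j := s j - 1) = t(j := t j - 1)"
      using uv(3) by (auto simp: u v h_def)
    have "s j - 1 = t j - 1" using fun_cong[OF eq, of j] by simp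
    moreover have "s j \<noteq> 0" "t j \<noteq> 0" using uv by (auto simp: u v ij D_def supp_def)
    ultimately have "s j = t j" by simp
    moreover have "s l = t l" if "l \<noteq> j" for l using fun_cong[OF eq, of l] that by simp
    ultimately have "s = t" by (intro ext) metis
    then show "u = v" by (simp add: u v ij)
  qed
  have img: "h ` D \<subseteq> F' \<times> A"
    by (auto simp: h_def F'_def A_def D_def)
  have F': "F' \<subseteq> {s \<in> Fseq. snorm1 s = n}"
  proof
    fix t assume "t \<in> F'"
    then obtain s j where sj: "s \<in> F" "j \<in> supp s" "t = s(j := s j - 1)"
      by (auto simp: F'_def D_def)
    then show "t \<in> {s \<in> Fseq. snorm1 s = n}"
      using snorm1_decrement[OF Fs(1)[OF sj(1)] sj(2)] Fs[OF sj(1)]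
      by (auto intro: Fseq_update)
  qed
  have "(\<Sum>s\<in>F. multinomial_term b s)
      = (\<Sum>s\<in>F. \<Sum>j\<in>supp s. b j * multinomial_term b (s(j := s j - 1)))"
    using Fs by (intro sum.cong refl multinomial_term_recurrence) auto
  also have "\<dots> = (\<Sum>(s, j)\<in>D. b j * multinomial_term b (s(j := s j - 1)))"
    unfolding D_def using Suc.prems(1) Fs by (intro sum.Sigma) auto
  also have "\<dots> = (\<Sum>(t, j)\<in>h ` D. b j * multinomial_term b t)"
    by (subst sum.reindex[OF inj]) (auto simp: h_def intro!: sum.cong)
  also have "\<dots> \<le> (\<Sum>(t, j)\<in>F' \<times> A. b j * multinomial_term b t)"
    using finF' finA b(1) by (intro sum_mono2[OF _ img]) (auto intro!: mult_nonneg_nonneg multinomial_term_nonneg)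
  also have "\<dots> = (\<Sum>t\<in>F'. \<Sum>j\<in>A. multinomial_term b t * b j)"
    by (simp add: sum.cartesian_product[symmetric] mult.commute)
  also have "\<dots> = (\<Sum>t\<in>F'. multinomial_term b t) * (\<Sum>j\<in>A. b j)"
    by (simp add: sum_product)
  also have "\<dots> \<le> suminf b ^ n * suminf b"
    using b Suc.IH[OF finF' F'] sum_le_suminf[OF b(2) finA]
    by (intro mult_mono) (auto intro!: sum_nonneg zero_le_power suminf_nonneg multinomial_term_nonneg)
  finally show ?case by (simp add: mult.commute)
qed

lemma multinomial_term_le:
  assumes b: "\<And>j. 0 \<le> b j" "summable b" and s: "s \<in> Fseq"
  shows "multinomial_term b s \<le> suminf b ^ snorm1 s"
  using sum_multinomial_term_le[OF b, of "{s}" "snorm1 s"] s by simp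

section \<open>Decay of the multinomial terms\<close>

text \<open>The levels \<open>snorm1 s = n\<close> are infinite sets, so the hypothesis is formulated for their finite
  subsets; this is the form in which the multinomial theorem is available.\<close>

lemma summable_on_Fseq_by_levels:
  fixes f :: "(nat \<Rightarrow> nat) \<Rightarrow> real" and g :: "nat \<Rightarrow> real"
  assumes f: "\<And>s. s \<in> Fseq \<Longrightarrow> 0 \<le> f s"
    and g: "summable g"
    and le: "\<And>n F. finite F \<Longrightarrow> F \<subseteq> {s \<in> Fseq. snorm1 s = n} \<Longrightarrow> sum f F \<le> g n"
  shows "f summable_on Fseq"
proof (rule nonneg_bdd_above_summable_on[OF f])
  have g0: "0 \<le> g n" for n using le[of "{}" n] by simp
  show "bdd_above (sum f ` {F. F \<subseteq> Fseq \<and> finite F})"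
  proof (rule bdd_aboveI2)
    fix F assume "F \<in> {F. F \<subseteq> Fseq \<and> finite F}"
    then have F: "F \<subseteq> Fseq" "finite F" by auto
    have "sum f F = (\<Sum>n\<in>snorm1 ` F. sum f {s \<in> F. snorm1 s = n})"
      by (rule sum.image_gen[OF F(2)])
    also have "\<dots> \<le> (\<Sum>n\<in>snorm1 ` F. g n)"
      using F by (intro sum_mono le) auto
    also have "\<dots> \<le> suminf g"
      using F(2) g g0 by (intro sum_le_suminf) auto
    finally show "sum f F \<le> suminf g" .
  qed
qed auto

text \<open>The upper half of Stirling's formula up to a factor of order \<open>sqrt n\<close>. A fixed power of \<open>n\<close> may be
  lost here, since the decay used against it comes with an arbitrarily large exponent.\<close>

lemma fact_mult_exp_le:
  assumes "n \<ge> 1"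
  shows "fact n * exp (real n) \<le> exp 1 * real n ^ Suc n"
  using assms
proof (induction n rule: dec_induct)
  case base
  then show ?case by simp
next
  case (step n)
  have "real n / real (Suc n) \<le> exp (- (1 / real (Suc n)))"
    using exp_ge_add_one_self[of "- (1 / real (Suc n))"] by (simp add: field_simps)
  then have "(real n / real (Suc n)) ^ Suc n \<le> exp (- (1 / real (Suc n))) ^ Suc n"
    by (intro power_mono) auto
  also have "\<dots> = exp (real (Suc n) * (- (1 / real (Suc n))))"
    by (rule exp_of_nat_mult[symmetric])
  also have "\<dots> = exp (-1)" by simp
  finally have "exp 1 * real n ^ Suc n \<le> real (Suc n) ^ Suc n"
    by (simp add: power_divide exp_minus field_simps del: power_Suc of_nat_Suc)
  then have "fact n * exp (real n) \<le> real (Suc n) ^ Suc n"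
    using step.IH by linarith
  then have "exp 1 * (real (Suc n) * (fact n * exp (real n)))
      \<le> exp 1 * (real (Suc n) * real (Suc n) ^ Suc n)"
    by (intro mult_left_mono) auto
  moreover have "exp 1 * (real (Suc n) * (fact n * exp (real n))) = fact (Suc n) * exp (real (Suc n))"
    by (simp add: exp_add)
  ultimately show ?case
    by (simp only: power_Suc[of "real (Suc n)" "Suc n"])
qed

text \<open>With \<open>x = 1 / k\<close> this says \<open>(1 + 1/k) powr (k + 1/4) \<le> e\<close>, the induction step of the next lemma.
  The same argument works with any \<open>\<delta> > 0\<close> such that \<open>2 \<delta> + \<delta>\<^sup>2 \<le> 1\<close> in place of \<open>1/4\<close>.\<close>

lemma ln_one_plus_le_quarter:
  fixes x :: real
  assumes "0 \<le> x" "x \<le> 1"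
  shows "ln (1 + x) \<le> x / (1 + x / 4)"
proof -
  define f where "f = (\<lambda>x::real. x / (1 + x / 4) - ln (1 + x))"
  have "f 0 \<le> f x"
  proof (rule DERIV_nonneg_imp_nondecreasing[OF assms(1)])
    fix y :: real assume y: "0 \<le> y" "y \<le> x"
    have "(f has_real_derivative 1 / (1 + y / 4)\<^sup>2 - 1 / (1 + y)) (at y)"
      unfolding f_def using y
      by (auto intro!: derivative_eq_intros simp: power2_eq_square field_simps)
    moreover have "(1 + y / 4)\<^sup>2 \<le> 1 + y"
      using y assms mult_mono[of y 1 y y] by (simp add: power2_eq_square field_simps)
    then have "1 / (1 + y) \<le> 1 / (1 + y / 4)\<^sup>2"
      using y by (intro divide_left_mono) auto
    ultimately show "\<exists>z. (f has_real_derivative z) (at y) \<and> 0 \<le> z" by auto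
  qed
  then show ?thesis by (simp add: f_def)
qed

text \<open>The lower half of Stirling's formula with \<open>k powr (1/4)\<close> in place of \<open>sqrt (2 pi k)\<close>. This power of
  \<open>k\<close>, however small, is the source of the decay of the multinomial terms.\<close>

lemma power_self_le_fact:
  assumes "k \<ge> 1"
  shows "real k powr (1/4) * real k ^ k \<le> fact k * exp (real k)"
  using assms
proof (induction k rule: dec_induct)
  case base
  then show ?case by simp
next
  case (step k)
  have k: "real k > 0" using step by simp
  have "(real k + 1/4) * ln (1 + 1 / real k) \<le> (real k + 1/4) * (1 / real k / (1 + 1 / real k / 4))"
    using k step by (intro mult_left_mono ln_one_plus_le_quarter) auto
  also have "\<dots> = 1" using k by (simp add: field_simps)
  finally have "(1 + 1 / real k) powr (real k + 1/4) \<le> exp 1"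
    using k by (simp add: powr_def add_pos_pos)
  moreover have "1 + 1 / real k = real (Suc k) / real k" using k by (simp add: field_simps)
  ultimately have "real (Suc k) powr (real k + 1/4) \<le> exp 1 * real k powr (real k + 1/4)"
    using k by (simp add: powr_divide field_simps del: of_nat_Suc)
  also have "real k powr (real k + 1/4) = real k powr (1/4) * real k ^ k"
    using k by (simp add: powr_add powr_realpow)
  also have "exp 1 * \<dots> \<le> exp 1 * (fact k * exp (real k))"
    using step.IH by (intro mult_left_mono) auto
  finally have "real (Suc k) * real (Suc k) powr (real k + 1/4)
      \<le> real (Suc k) * (exp 1 * (fact k * exp (real k)))"
    by (intro mult_left_mono) auto
  moreover have "real (Suc k) * real (Suc k) powr (real k + 1/4)
      = real (Suc k) powr (1/4) * real (Suc k) ^ Suc k"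
    by (simp add: powr_add powr_realpow del: of_nat_Suc)
  moreover have "real (Suc k) * (exp 1 * (fact k * exp (real k))) = fact (Suc k) * exp (real (Suc k))"
    by (simp add: exp_add)
  ultimately show ?case by (simp only:)
qed

lemma poisson_weight_le_exp:
  fixes y :: real
  assumes "0 \<le> y"
  shows "y ^ k / fact k \<le> exp y"
proof -
  have "(\<Sum>i\<in>{k}. inverse (fact i) * y ^ i) \<le> (\<Sum>i. inverse (fact i) * y ^ i)"
    using assms by (intro sum_le_suminf summable_exp) auto
  then show ?thesis by (simp add: exp_def field_simps)
qed

text \<open>The Poisson weight \<open>y ^ k exp (- y) / k!\<close> is largest at \<open>y = k\<close>, where the previous bound on the
  factorial applies. The factor 2 pays for \<open>k + 1\<close> in place of \<open>k\<close>.\<close>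

lemma poisson_weight_le:
  fixes y :: real
  assumes "0 \<le> y"
  shows "y ^ k / fact k \<le> exp y * (2 * real (Suc k) powr (-1/4))"
proof (cases "k = 0")
  case True
  have "1 \<le> exp y * 2" using exp_ge_add_one_self[of y] assms by linarith
  then show ?thesis using True by simp
next
  case False
  then have k: "real k > 0" "k \<ge> 1" by auto
  have "y / real k \<le> exp (y / real k - 1)"
    using exp_ge_add_one_self[of "y / real k - 1"] by simp
  then have "(y / real k) ^ k \<le> exp (y / real k - 1) ^ k"
    using assms k by (intro power_mono) auto
  also have "\<dots> = exp (real k * (y / real k - 1))" by (rule exp_of_nat_mult[symmetric])
  also have "real k * (y / real k - 1) = y - real k" using k by (simp add: field_simps)
  finally have "y ^ k \<le> exp y / exp (real k) * real k ^ k"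
    using k by (simp add: power_divide exp_diff field_simps)
  also have "\<dots> \<le> exp y / exp (real k) * (fact k * exp (real k) * real k powr (-1/4))"
  proof (intro mult_left_mono)
    have "real k ^ k = (real k powr (1/4) * real k ^ k) * real k powr (-1/4)"
      using k by (simp add: powr_minus field_simps)
    also have "\<dots> \<le> (fact k * exp (real k)) * real k powr (-1/4)"
      by (intro mult_right_mono power_self_le_fact k) auto
    finally show "real k ^ k \<le> fact k * exp (real k) * real k powr (-1/4)" .
  qed auto
  finally have "y ^ k / fact k \<le> exp y * real k powr (-1/4)"
    by (simp add: field_simps)
  also have "real k powr (-1/4) \<le> 2 * real (Suc k) powr (-1/4)"
  proof -
    have "real (Suc k) powr (1/4) \<le> (2 * real k) powr (1/4)"
      using k by (intro powr_mono2) auto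
    also have "\<dots> = 2 powr (1/4) * real k powr (1/4)" by (rule powr_mult)
    also have "\<dots> \<le> 2 powr 1 * real k powr (1/4)"
      by (intro mult_right_mono powr_mono) auto
    finally show ?thesis using k by (simp add: powr_minus field_simps)
  qed
  finally show ?thesis by simp
qed

text \<open>With \<open>n = snorm1 s\<close>, multiplying the term by \<open>n ^ n / n!\<close> gives the product of \<open>(n b\<^sub>j)^s\<^sub>j / s\<^sub>j!\<close>.
  The first \<open>d\<close> factors are bounded by \<open>exp (n b\<^sub>j)\<close> times a negative power of \<open>s\<^sub>j + 1\<close>, the others
  by \<open>exp (n b\<^sub>j)\<close>; the exponentials multiply to at most \<open>exp n\<close>, which Stirling's formula cancels.\<close>

lemma multinomial_term_decay:
  assumes b: "\<And>j. 0 \<le> b j" "summable b" "suminf b \<le> 1" and s: "s \<in> Fseq"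
  shows "multinomial_term b s
    \<le> exp 1 * real (Suc (snorm1 s)) * (\<Prod>j<d. 2 * real (Suc (s j)) powr (-1/4))"
proof -
  define n where "n = snorm1 s"
  define A where "A = supp s \<union> {..<d}"
  have A: "finite A" "supp s \<subseteq> A" using s by (auto simp: A_def Fseq_iff)
  define w where "w = (\<lambda>j. if j < d then 2 * real (Suc (s j)) powr (-1/4) else 1)"
  have w: "prod w A = (\<Prod>j<d. 2 * real (Suc (s j)) powr (-1/4))"
    using A(1) by (intro prod.mono_neutral_cong_right) (auto simp: A_def w_def)
  have "(\<Prod>j\<in>A. (real n * b j) ^ s j / fact (s j)) \<le> (\<Prod>j\<in>A. exp (real n * b j) * w j)"
  proof (intro prod_mono conjI)
    fix j assume "j \<in> A"
    show "0 \<le> (real n * b j) ^ s j / fact (s j)" using b(1) by simp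
    show "(real n * b j) ^ s j / fact (s j) \<le> exp (real n * b j) * w j"
      using poisson_weight_le[of "real n * b j" "s j"] poisson_weight_le_exp[of "real n * b j" "s j"] b(1)
      by (simp add: w_def)
  qed
  also have "\<dots> = exp (real n * sum b A) * prod w A"
    using A(1) by (simp add: prod.distrib exp_sum[symmetric] sum_distrib_left)
  also have "\<dots> \<le> exp (real n) * prod w A"
  proof (intro mult_right_mono prod_nonneg)
    have "sum b A \<le> 1" using sum_le_suminf[OF b(2) A(1)] b by force
    then show "exp (real n * sum b A) \<le> exp (real n)" by (simp add: mult_left_le)
  qed (auto simp: w_def)
  finally have le: "(\<Prod>j\<in>A. (real n * b j) ^ s j / fact (s j)) \<le> exp (real n) * prod w A" .
  have "(\<Prod>j\<in>A. real n ^ s j) = real n ^ n"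
    unfolding n_def snorm1_eq_sum[OF A] power_sum ..
  then have eq: "(\<Prod>j\<in>A. (real n * b j) ^ s j / fact (s j))
      = real n ^ n * (\<Prod>j\<in>A. b j ^ s j / fact (s j))"
    by (simp add: power_mult_distrib prod.distrib prod_dividef)
  have nn: "real n ^ n > 0" by (cases "n = 0") auto
  have stirling: "fact n * exp (real n) \<le> exp 1 * real (Suc n) * real n ^ n"
  proof (cases "n = 0")
    case False
    then have "fact n * exp (real n) \<le> exp 1 * (real n * real n ^ n)"
      using fact_mult_exp_le[of n] by simp
    also have "\<dots> \<le> exp 1 * (real (Suc n) * real n ^ n)"
      by (intro mult_left_mono mult_right_mono) auto
    finally show ?thesis by (simp only: mult.assoc)
  qed auto
  have w0: "0 \<le> prod w A" by (intro prod_nonneg) (auto simp: w_def)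
  have "real n ^ n * multinomial_term b s
      = fact n * (real n ^ n * (\<Prod>j\<in>A. b j ^ s j / fact (s j)))"
    by (simp add: multinomial_term_eq[OF A] n_def)
  also have "\<dots> \<le> fact n * (exp (real n) * prod w A)"
    using le unfolding eq by (intro mult_left_mono) auto
  also have "\<dots> = (fact n * exp (real n)) * prod w A" by simp
  also have "\<dots> \<le> (exp 1 * real (Suc n) * real n ^ n) * prod w A"
    by (intro mult_right_mono stirling w0)
  also have "\<dots> = real n ^ n * (exp 1 * real (Suc n) * prod w A)" by simp
  finally show ?thesis
    using nn unfolding w n_def by (subst (asm) mult_le_cancel_left_pos) auto
qed

lemma fact_add_ge: "fact n * real (Suc n) ^ d \<le> fact (n + d)"
proof (induction d)
  case (Suc d)
  have "fact n * real (Suc n) ^ Suc d = real (Suc n) * (fact n * real (Suc n) ^ d)" by simp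
  also have "\<dots> \<le> real (Suc (n + d)) * fact (n + d)"
    by (intro mult_mono Suc.IH) auto
  finally show ?case by simp
qed simp

text \<open>Dividing a multinomial term by \<open>s\<^sub>j + 1\<close> for \<open>j < d\<close> turns the factorials into those of the sequence
  with these entries raised by one. Up to the factor \<open>n! / (n + d)!\<close> and the product of the first \<open>d\<close> entries of \<open>b\<close>, the sum is
  therefore a part of the level \<open>n + d\<close>, whose total is at most 1.\<close>

lemma sum_multinomial_term_divide_le:
  assumes b: "\<And>j. 0 < b j" "summable b" "suminf b \<le> 1"
    and F: "finite F" "F \<subseteq> {s \<in> Fseq. snorm1 s = n}"
  shows "(\<Sum>s\<in>F. multinomial_term b s / (\<Prod>j<d. real (Suc (s j))))
    \<le> 1 / ((\<Prod>j<d. b j) * real (Suc n) ^ d)"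
proof -
  define up where "up = (\<lambda>(s::nat \<Rightarrow> nat) j. if j < d then Suc (s j) else s j)"
  have b0: "0 \<le> b j" for j using b(1)[of j] by simp
  have B: "(\<Prod>j<d. b j) > 0" using b(1) by (intro prod_pos) auto
  have inj: "inj_on up F"
  proof (rule inj_onI)
    fix s t assume "up s = up t"
    then have eq: "up s j = up t j" for j by simp
    have "s j = t j" for j using eq[of j] by (simp add: up_def split: if_splits)
    then show "s = t" by auto
  qed
  have sub: "supp (up s) \<subseteq> supp s \<union> {..<d}" for s by (auto simp: supp_def up_def)
  have norm: "snorm1 (up s) = snorm1 s + d" if "s \<in> Fseq" for s
  proof -
    have fin: "finite (supp s \<union> {..<d})" using that by (simp add: Fseq_iff)
    have "snorm1 (up s) = (\<Sum>j\<in>supp s \<union> {..<d}. s j + (if j < d then 1 else 0))"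
      unfolding snorm1_eq_sum[OF fin sub] by (intro sum.cong) (auto simp: up_def)
    also have "\<dots> = snorm1 s + (\<Sum>j\<in>supp s \<union> {..<d}. if j < d then 1 else 0)"
      using snorm1_eq_sum[OF fin, of s] by (simp add: sum.distrib)
    also have "(\<Sum>j\<in>supp s \<union> {..<d}. if j < d then 1 else (0::nat)) = (\<Sum>j<d. 1)"
      using fin by (intro sum.mono_neutral_cong_right) auto
    finally show ?thesis by simp
  qed
  have step: "multinomial_term b s / (\<Prod>j<d. real (Suc (s j)))
      \<le> multinomial_term b (up s) * (1 / ((\<Prod>j<d. b j) * real (Suc n) ^ d))" if "s \<in> F" for s
  proof -
    have s: "s \<in> Fseq" "snorm1 s = n" using that F by auto
    define A where "A = supp s \<union> {..<d}"
    have A: "finite A" "supp s \<subseteq> A" "supp (up s) \<subseteq> A"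
      using s sub by (auto simp: A_def Fseq_iff)
    define P where "P = (\<Prod>j\<in>A. b j ^ s j / fact (s j))"
    have P0: "0 \<le> P" unfolding P_def using b0 by (intro prod_nonneg) auto
    have "(\<Prod>j\<in>A. b j ^ up s j / fact (up s j))
        = (\<Prod>j\<in>A. b j ^ s j / fact (s j) * (if j < d then b j / real (Suc (s j)) else 1))"
      by (intro prod.cong) (auto simp: up_def)
    also have "\<dots> = P * (\<Prod>j\<in>A. if j < d then b j / real (Suc (s j)) else 1)"
      unfolding P_def by (rule prod.distrib)
    also have "(\<Prod>j\<in>A. if j < d then b j / real (Suc (s j)) else 1) = (\<Prod>j<d. b j / real (Suc (s j)))"
      using A(1) by (intro prod.mono_neutral_cong_right) (auto simp: A_def)
    finally have up: "multinomial_term b (up s)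
        = fact (n + d) * (P * ((\<Prod>j<d. b j) / (\<Prod>j<d. real (Suc (s j)))))"
      using norm[OF s(1)] s(2) by (simp add: multinomial_term_eq[OF A(1,3)] prod_dividef)
    define D where "D = (\<Prod>j<d. real (Suc (s j)))"
    have D: "D > 0" unfolding D_def by (intro prod_pos) auto
    have "multinomial_term b s / D = (fact n * real (Suc n) ^ d) * (P / (D * real (Suc n) ^ d))"
      using s(2) by (simp add: multinomial_term_eq[OF A(1,2)] P_def)
    also have "\<dots> \<le> fact (n + d) * (P / (D * real (Suc n) ^ d))"
      using D P0 by (intro mult_right_mono fact_add_ge) auto
    also have "\<dots> = multinomial_term b (up s) * (1 / ((\<Prod>j<d. b j) * real (Suc n) ^ d))"
      unfolding up D_def[symmetric] using less_imp_neq[OF B] by simp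
    finally show ?thesis unfolding D_def .
  qed
  have "(\<Sum>s\<in>F. multinomial_term b s / (\<Prod>j<d. real (Suc (s j))))
      \<le> (\<Sum>s\<in>F. multinomial_term b (up s) * (1 / ((\<Prod>j<d. b j) * real (Suc n) ^ d)))"
    by (intro sum_mono step)
  also have "\<dots> = (\<Sum>t\<in>up ` F. multinomial_term b t) * (1 / ((\<Prod>j<d. b j) * real (Suc n) ^ d))"
    by (simp only: sum.reindex[OF inj] sum_distrib_right o_def)
  also have "\<dots> \<le> 1 * (1 / ((\<Prod>j<d. b j) * real (Suc n) ^ d))"
  proof (intro mult_right_mono)
    have "up ` F \<subseteq> {s \<in> Fseq. snorm1 s = n + d}"
      using F(2) norm finite_subset[OF sub] by (force simp: Fseq_iff)
    then have "(\<Sum>t\<in>up ` F. multinomial_term b t) \<le> suminf b ^ (n + d)"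
      using F(1) by (intro sum_multinomial_term_le b0 b) auto
    also have "\<dots> \<le> 1" using b b0 by (intro power_le_one suminf_nonneg) auto
    finally show "(\<Sum>t\<in>up ` F. multinomial_term b t) \<le> 1" .
  qed (use B in auto)
  finally show ?thesis by simp
qed

section \<open>Convergence of the series of powers of multinomial terms\<close>

text \<open>On a level of total mass at most 1, \<open>x\<^sub>s^(1 + e)\<close> is at most \<open>x\<^sub>s\<close> times a negative power of
  \<open>D s = \<Prod>j<d. (s\<^sub>j + 1)\<close>, up to powers of \<open>n + 1\<close>. The mean of \<open>1 / D\<close> is at most of order
  \<open>(n + 1)^(-d)\<close>, and so the mean of \<open>D^(-r)\<close> at most of order \<open>(n + 1)^(-d r)\<close> for \<open>r \<le> 1\<close>.
  For large \<open>d\<close> this beats the powers of \<open>n + 1\<close>.\<close>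

lemma multinomial_term_summable_supercritical:
  fixes p :: real
  assumes b: "\<And>j. 0 < b j" "summable b" "suminf b \<le> 1" and p: "1 < p"
  shows "(\<lambda>s. multinomial_term b s powr p) summable_on Fseq"
proof -
  define e where "e = min (p - 1) 1"
  have e: "0 < e" "e \<le> 1" "1 + e \<le> p" using p by (auto simp: e_def)
  define r where "r = e / 4"
  have r: "0 < r" "r \<le> 1" using e by (auto simp: r_def)
  \<comment> \<open>The level sums will be of order \<open>(n + 1) powr (e - d r)\<close>; this exponent has to be at most \<open>-2\<close>.\<close>
  obtain d :: nat where "real d > 4 * (1 + 2 / e)" using reals_Archimedean2 by blast
  then have d: "real d * r \<ge> 2 + e"
    using e by (simp add: r_def field_simps)
  have b0: "0 \<le> b j" for j using b(1)[of j] by simp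
  define K where "K = 1 + 1 / (\<Prod>j<d. b j)"
  have B: "(\<Prod>j<d. b j) > 0" using b(1) by (intro prod_pos) auto
  have K: "K > 0" using B by (simp add: K_def add_pos_pos)
  define c where "c = (exp 1 * 2 ^ d) powr e"
  have c: "c > 0" by (simp add: c_def)
  let ?x = "multinomial_term b"
  have x01: "0 \<le> ?x s" "?x s \<le> 1" if "s \<in> Fseq" for s
  proof -
    show "0 \<le> ?x s" by (rule multinomial_term_nonneg[OF b0])
    have "?x s \<le> suminf b ^ snorm1 s" by (rule multinomial_term_le[OF b0 b(2) that])
    also have "\<dots> \<le> 1" using b b0 by (intro power_le_one suminf_nonneg) auto
    finally show "?x s \<le> 1" .
  qed
  have main: "(\<Sum>s\<in>F. ?x s powr p) \<le> c * K * real (Suc n) powr (-2)"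
    if F: "finite F" "F \<subseteq> {s \<in> Fseq. snorm1 s = n}" for F n
  proof -
    define N where "N = real (Suc n)"
    have N: "N \<ge> 1" by (simp add: N_def)
    define L where "L = N ^ d"
    have L: "L > 0" using N by (simp add: L_def)
    define D where "D = (\<lambda>s::nat \<Rightarrow> nat. \<Prod>j<d. real (Suc (s j)))"
    have D: "D s > 0" for s unfolding D_def by (intro prod_pos) auto
    have term_le: "?x s powr p \<le> c * N powr e * L powr (-r) * (?x s + L * (?x s / D s))"
      if "s \<in> F" for s
    proof -
      have s: "s \<in> Fseq" "snorm1 s = n" using that F by auto
      note x = x01[OF s(1)]
      have decay: "?x s \<le> exp 1 * 2 ^ d * N * D s powr (-1/4)"
      proof -
        have "(\<Prod>j<d. 2 * real (Suc (s j)) powr (-1/4)) = 2 ^ d * D s powr (-1/4)"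
          by (simp add: prod.distrib prod_powr_distrib D_def del: of_nat_Suc)
        then show ?thesis
          using multinomial_term_decay[OF b0 b(2,3) s(1), of d] s(2) by (simp add: N_def mult_ac)
      qed
      have "?x s powr e \<le> (exp 1 * 2 ^ d * N * D s powr (-1/4)) powr e"
        using decay x e by (intro powr_mono2) auto
      also have "\<dots> = c * N powr e * D s powr (-r)"
        using N by (simp add: powr_mult powr_powr c_def r_def)
      finally have xe: "?x s powr e \<le> c * N powr e * D s powr (-r)" .
      \<comment> \<open>As \<open>u powr r \<le> 1 + u\<close>, the mean of \<open>D powr (-r)\<close> is bounded through the mean of \<open>1 / D\<close>, which is at most of order \<open>1 / L\<close>.\<close>
      have "(L / D s) powr r \<le> 1 + L / D s"
      proof (cases "L / D s \<le> 1")
        case True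
        then have "(L / D s) powr r \<le> 1 powr r" using L D r by (intro powr_mono2) auto
        also have "\<dots> \<le> 1 + L / D s" using L D[of s] by simp
        finally show ?thesis .
      next
        case False
        then have "(L / D s) powr r \<le> (L / D s) powr 1" using r by (intro powr_mono) auto
        then show ?thesis using False by simp
      qed
      then have "L powr (-r) * (L / D s) powr r \<le> L powr (-r) * (1 + L / D s)"
        by (intro mult_left_mono) auto
      moreover have "L powr (-r) * (L / D s) powr r = D s powr (-r)"
        using L D[of s] by (simp add: powr_divide powr_minus field_simps)
      ultimately have Dr: "D s powr (-r) \<le> L powr (-r) * (1 + L / D s)" by simp
      have "?x s powr p \<le> ?x s powr (1 + e)"
        using x e(3) by (cases "?x s = 0") (auto intro!: powr_mono')
      also have "\<dots> = ?x s * ?x s powr e"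
        using x by (cases "?x s = 0") (auto simp: powr_add)
      also have "\<dots> \<le> ?x s * (c * N powr e * (L powr (-r) * (1 + L / D s)))"
        using Dr x c by (intro mult_left_mono order.trans[OF xe]) auto
      also have "\<dots> = c * N powr e * L powr (-r) * (?x s + L * (?x s / D s))"
        by (simp add: algebra_simps)
      finally show ?thesis .
    qed
    have "(\<Sum>s\<in>F. ?x s powr p)
        \<le> (\<Sum>s\<in>F. c * N powr e * L powr (-r) * (?x s + L * (?x s / D s)))"
      by (intro sum_mono term_le)
    also have "\<dots> = c * N powr e * L powr (-r) * (sum ?x F + L * (\<Sum>s\<in>F. ?x s / D s))"
      by (simp only: sum_distrib_left[symmetric] sum.distrib)
    also have "\<dots> \<le> c * N powr e * L powr (-r) * K"
    proof (intro mult_left_mono)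
      have "sum ?x F \<le> suminf b ^ n" by (rule sum_multinomial_term_le[OF b0 b(2) F])
      also have "\<dots> \<le> 1" using b b0 by (intro power_le_one suminf_nonneg) auto
      finally have 1: "sum ?x F \<le> 1" .
      have "(\<Sum>s\<in>F. ?x s / D s) \<le> 1 / ((\<Prod>j<d. b j) * L)"
        unfolding D_def L_def N_def by (rule sum_multinomial_term_divide_le[OF b F])
      then have "L * (\<Sum>s\<in>F. ?x s / D s) \<le> L * (1 / ((\<Prod>j<d. b j) * L))"
        using L by (intro mult_left_mono) auto
      also have "\<dots> = 1 / (\<Prod>j<d. b j)" using L by simp
      finally show "sum ?x F + L * (\<Sum>s\<in>F. ?x s / D s) \<le> K" using 1 by (simp add: K_def)
    qed (use c in auto)
    also have "\<dots> = c * K * N powr (e - real d * r)"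
      using N by (simp add: L_def powr_powr powr_realpow[symmetric] powr_add[symmetric])
    also have "\<dots> \<le> c * K * N powr (-2)"
      using d c K N by (intro mult_left_mono powr_mono) auto
    finally show ?thesis by (simp add: N_def)
  qed
  have "summable (\<lambda>n. c * K * real (Suc n) powr (-2))"
    using summable_Suc_iff[of "\<lambda>n. real n powr (-2)"]
    by (intro summable_mult) (simp add: summable_real_powr_iff)
  from summable_on_Fseq_by_levels[OF _ this main] show ?thesis by simp
qed

text \<open>The binomial coefficient \<open>(i + l) choose i\<close> links the terms of the two parts to that of \<open>s\<close>. A single
  summand of \<open>(q + (1 - q)) ^ (i + l) = 1\<close> is at most 1, so this coefficient is at most
  \<open>q^(-i) (1 - q)^(-l)\<close>, and these powers are absorbed by rescaling \<open>b\<close>.\<close>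

lemma multinomial_term_split_le:
  fixes q :: real and J :: nat
  assumes b: "\<And>j. 0 \<le> b j" and q: "0 < q" "q < 1" and s: "s \<in> Fseq"
  defines "t \<equiv> \<lambda>j. if j < J then s j else 0"
    and "u \<equiv> \<lambda>j. if j < J then 0 else s j"
  shows "multinomial_term b s
    \<le> multinomial_term (\<lambda>j. b j / q) t * multinomial_term (\<lambda>j. b j / (1 - q)) u"
proof -
  define A where "A = supp s"
  have A: "finite A" "supp s \<subseteq> A" "supp t \<subseteq> A" "supp u \<subseteq> A"
    using s by (auto simp: A_def Fseq_iff t_def u_def supp_def)
  define P where "P = (\<lambda>s::nat \<Rightarrow> nat. \<Prod>j\<in>A. b j ^ s j / fact (s j))"
  have P0: "0 \<le> P s" for s unfolding P_def using b by (intro prod_nonneg) auto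
  have scale: "multinomial_term (\<lambda>j. b j / c) v = fact (snorm1 v) * P v / c ^ snorm1 v"
    if "supp v \<subseteq> A" for c :: real and v
    unfolding multinomial_term_eq[OF A(1) that] P_def snorm1_eq_sum[OF A(1) that] power_sum
    by (simp add: power_divide prod_dividef prod.distrib mult.commute)
  have P: "P s = P t * P u"
    unfolding P_def prod.distrib[symmetric] by (intro prod.cong) (auto simp: t_def u_def)
  have n: "snorm1 s = snorm1 t + snorm1 u"
    unfolding snorm1_eq_sum[OF A(1,2)] snorm1_eq_sum[OF A(1,3)] snorm1_eq_sum[OF A(1,4)]
      sum.distrib[symmetric]
    by (intro sum.cong) (auto simp: t_def u_def)
  define i l where "i = snorm1 t" and "l = snorm1 u"
  have "of_nat ((i + l) choose i) * q ^ i * (1 - q) ^ (i + l - i)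
      \<le> (\<Sum>k\<le>i + l. of_nat ((i + l) choose k) * q ^ k * (1 - q) ^ (i + l - k))"
    using q by (intro member_le_sum) auto
  also have "\<dots> = (q + (1 - q)) ^ (i + l)" by (rule binomial_ring[symmetric])
  finally have "of_nat ((i + l) choose i) * q ^ i * (1 - q) ^ l \<le> 1" by simp
  moreover have "real ((i + l) choose i) = fact (i + l) / (fact i * fact l)"
    using binomial_fact[of i "i + l"] by simp
  ultimately have "fact (i + l) \<le> fact i / q ^ i * (fact l / (1 - q) ^ l)"
    using q by (simp add: field_simps)
  then have "fact (i + l) * (P t * P u) \<le> fact i / q ^ i * (fact l / (1 - q) ^ l) * (P t * P u)"
    by (intro mult_right_mono mult_nonneg_nonneg P0)
  moreover have "multinomial_term b s = fact (i + l) * (P t * P u)"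
    using scale[OF A(2), of 1] n by (simp add: P i_def l_def)
  ultimately show ?thesis
    by (simp add: scale A i_def l_def mult_ac)
qed

lemma sfact_le_fact_snorm1: "s \<in> Fseq \<Longrightarrow> sfact s \<le> fact (snorm1 s)"
proof -
  assume "s \<in> Fseq"
  then have "finite (supp s)" by (simp add: Fseq_iff)
  then have "(\<Prod>j\<in>supp s. fact (s j)) \<le> (fact (\<Sum>j\<in>supp s. s j) :: real)"
  proof induction
    case (insert x A)
    have "fact (s x) * (\<Prod>j\<in>A. fact (s j)) \<le> fact (s x) * (fact (sum s A) :: real)"
      using insert.IH by (intro mult_left_mono) auto
    also have "\<dots> = real (fact (s x) * fact (sum s A))" by simp
    also have "\<dots> \<le> real (fact (s x + sum s A))"
      by (intro of_nat_mono dvd_imp_le fact_fact_dvd_fact) auto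
    finally show ?case using insert by simp
  qed simp
  then show ?thesis by (simp add: sfact_def snorm1_def)
qed

lemma power_powr_swap:
  fixes x p :: real
  assumes "0 \<le> x"
  shows "(x ^ n) powr p = (x powr p) ^ n"
  using assms
  by (cases "x = 0"; cases "n = 0") (auto simp: power_0_left powr_realpow[symmetric] powr_powr mult.commute)

text \<open>A multinomial coefficient is at least 1, so that an exponent \<open>p \<le> 1\<close> does not increase it.\<close>

lemma multinomial_term_powr_le:
  fixes p :: real
  assumes b: "\<And>j. 0 \<le> b j" and p: "0 < p" "p \<le> 1" and s: "s \<in> Fseq"
  shows "multinomial_term b s powr p \<le> multinomial_term (\<lambda>j. b j powr p) s"
proof -
  have ge1: "1 \<le> fact (snorm1 s) / sfact s"
    using sfact_le_fact_snorm1[OF s] sfact_pos[of s] by simp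
  have spow: "spow b s powr p = spow (\<lambda>j. b j powr p) s"
    unfolding spow_def using b by (simp add: prod_powr_distrib power_powr_swap)
  have "multinomial_term b s powr p = (fact (snorm1 s) / sfact s) powr p * spow b s powr p"
    unfolding multinomial_term_def by (rule powr_mult)
  also have "\<dots> \<le> (fact (snorm1 s) / sfact s) powr 1 * spow b s powr p"
    using ge1 p by (intro mult_right_mono powr_mono) auto
  also have "\<dots> = multinomial_term (\<lambda>j. b j powr p) s"
    using sfact_pos[of s] by (simp add: multinomial_term_def spow)
  finally show ?thesis .
qed

text \<open>The sum over all sequences supported in \<open>{..<J}\<close> factors into \<open>J\<close> geometric series.\<close>

lemma sum_power_snorm1_le:
  fixes q :: real
  assumes q: "0 \<le> q" "q < 1" and U: "finite U" "\<And>t. t \<in> U \<Longrightarrow> supp t \<subseteq> {..<J}"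
  shows "(\<Sum>t\<in>U. q ^ snorm1 t) \<le> (1 / (1 - q)) ^ J"
proof -
  define N where "N = Max (insert 0 (\<Union>t\<in>U. t ` {..<J}))"
  have N: "t j \<le> N" if "t \<in> U" "j < J" for t j
    unfolding N_def using that U(1) by (intro Max_ge) auto
  define h where "h = (\<lambda>t::nat \<Rightarrow> nat. restrict t {..<J})"
  have inj: "inj_on h U"
  proof (rule inj_onI)
    fix s t assume st: "s \<in> U" "t \<in> U" "h s = h t"
    have "s j = t j" for j
    proof (cases "j < J")
      case True
      then show ?thesis using fun_cong[OF st(3), of j] by (simp add: h_def)
    next
      case False
      then show ?thesis using U(2)[OF st(1)] U(2)[OF st(2)] by (force simp: supp_def)
    qed
    then show "s = t" by auto
  qed
  have "(\<Sum>t\<in>U. q ^ snorm1 t) = (\<Sum>t\<in>U. \<Prod>j<J. q ^ h t j)"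
    using snorm1_eq_sum[of "{..<J}"] U(2) by (intro sum.cong) (auto simp: power_sum h_def)
  also have "\<dots> = (\<Sum>t\<in>h ` U. \<Prod>j<J. q ^ t j)" using inj by (simp add: sum.reindex)
  also have "\<dots> \<le> (\<Sum>t\<in>{..<J} \<rightarrow>\<^sub>E {..N}. \<Prod>j<J. q ^ t j)"
    using N q by (intro sum_mono2 finite_PiE) (auto simp: h_def intro!: prod_nonneg split: if_splits)
  also have "\<dots> = (\<Prod>j<J. \<Sum>i\<le>N. q ^ i)"
    by (rule prod_sum_PiE[symmetric]) auto
  also have "\<dots> \<le> (\<Prod>j<J. 1 / (1 - q))"
  proof (intro prod_mono conjI)
    have "(\<Sum>i\<le>N. q ^ i) \<le> (\<Sum>i. q ^ i)"
      using q by (intro sum_le_suminf summable_geometric) auto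
    then show "(\<Sum>i\<le>N. q ^ i) \<le> 1 / (1 - q)" using q by (simp add: suminf_geometric)
  qed (use q in \<open>auto intro: sum_nonneg\<close>)
  finally show ?thesis by simp
qed

text \<open>The parameter \<open>q\<close> lies between \<open>\<Sum>j. b j\<close> and 1. Dividing the first \<open>J\<close> entries of \<open>b\<close> by \<open>q\<close> keeps
  their sum below 1. The other entries are divided by the possibly tiny number \<open>1 - q\<close>, and \<open>J\<close> is chosen
  so large that the sum of their \<open>p\<close>-th powers is nevertheless less than 1.\<close>

lemma multinomial_term_summable_subcritical:
  fixes p :: real
  assumes b: "\<And>j. 0 \<le> b j" "summable b" "suminf b < 1"
    and p: "0 < p" "p \<le> 1" "summable (\<lambda>j. b j powr p)"
  shows "(\<lambda>s. multinomial_term b s powr p) summable_on Fseq"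
proof -
  define q where "q = (1 + suminf b) / 2"
  have sb0: "0 \<le> suminf b" using b by (intro suminf_nonneg) auto
  have q: "0 < q" "q < 1" "suminf b < q" using b(3) sb0 by (auto simp: q_def)
  define r where "r = suminf b / q"
  have r: "0 \<le> r" "r < 1" using sb0 q by (auto simp: r_def)
  define rp where "rp = r powr p"
  have rp: "0 \<le> rp" "rp < 1" using r p powr_less_mono2[of p r 1] by (auto simp: rp_def)
  define w where "w = (\<lambda>j. (b j / (1 - q)) powr p)"
  have w: "summable w" "\<And>j. 0 \<le> w j"
    using p(3) q b(1) by (auto simp: w_def powr_divide intro: summable_divide)
  obtain J where J: "(\<Sum>j. w (j + J)) < 1"
    using order_tendstoD(2)[OF suminf_exist_split2[OF w(1)], of 1] by (auto simp: eventually_sequentially)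
  define v where "v = (\<lambda>j. if j < J then 0 else w j)"
  have v: "summable v" "\<And>j. 0 \<le> v j" "suminf v < 1"
  proof -
    have eq: "v (j + J) = w (j + J)" for j by (simp add: v_def)
    show sv: "summable v"
      using w(1) summable_iff_shift[of v J] summable_iff_shift[of w J] by (simp add: eq)
    show "suminf v < 1"
      using suminf_split_initial_segment[OF sv, of J] J by (simp add: eq) (simp add: v_def)
  qed (simp add: v_def w)
  have sv0: "0 \<le> suminf v" using v by (intro suminf_nonneg) auto
  have tail: "multinomial_term v summable_on Fseq"
    by (rule summable_on_Fseq_by_levels[OF _ summable_geometric[of "suminf v"]])
       (use v sv0 in \<open>auto intro!: multinomial_term_nonneg sum_multinomial_term_le\<close>)
  define head where "head = (\<lambda>(s::nat \<Rightarrow> nat) j. if j < J then s j else 0)"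
  define rest where "rest = (\<lambda>(s::nat \<Rightarrow> nat) j. if j < J then 0 else s j)"
  have Fhead: "head s \<in> Fseq" and Frest: "rest s \<in> Fseq" if "s \<in> Fseq" for s
  proof -
    have "supp (head s) \<subseteq> supp s" "supp (rest s) \<subseteq> supp s"
      by (auto simp: supp_def head_def rest_def)
    then show "head s \<in> Fseq" "rest s \<in> Fseq"
      using that by (auto simp: Fseq_iff intro: finite_subset)
  qed
  have term_le: "multinomial_term b s powr p \<le> rp ^ snorm1 (head s) * multinomial_term v (rest s)"
    if s: "s \<in> Fseq" for s
  proof -
    have "multinomial_term b s
        \<le> multinomial_term (\<lambda>j. b j / q) (head s) * multinomial_term (\<lambda>j. b j / (1 - q)) (rest s)"
      unfolding head_def rest_def by (rule multinomial_term_split_le[OF b(1) q(1,2) s])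
    also have "\<dots> \<le> r ^ snorm1 (head s) * multinomial_term (\<lambda>j. b j / (1 - q)) (rest s)"
    proof (intro mult_right_mono)
      show "multinomial_term (\<lambda>j. b j / q) (head s) \<le> r ^ snorm1 (head s)"
        using multinomial_term_le[of "\<lambda>j. b j / q", OF _ _ Fhead[OF s]] b q
        by (simp add: r_def suminf_divide[symmetric] summable_divide)
    qed (use b q in \<open>auto intro!: multinomial_term_nonneg\<close>)
    finally have "multinomial_term b s powr p
        \<le> (r ^ snorm1 (head s) * multinomial_term (\<lambda>j. b j / (1 - q)) (rest s)) powr p"
      using p b by (intro powr_mono2) (auto intro: multinomial_term_nonneg)
    also have "\<dots> = rp ^ snorm1 (head s) * multinomial_term (\<lambda>j. b j / (1 - q)) (rest s) powr p"
      unfolding powr_mult rp_def using r p by (simp add: power_powr_swap)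
    also have "\<dots> \<le> rp ^ snorm1 (head s) * multinomial_term w (rest s)"
      unfolding w_def using rp b q p Frest[OF s] by (intro mult_left_mono multinomial_term_powr_le) auto
    also have "multinomial_term w (rest s) = multinomial_term v (rest s)"
      unfolding multinomial_term_def spow_def
      by (intro arg_cong2[where f = "(*)"] refl prod.cong) (auto simp: v_def rest_def supp_def)
    finally show ?thesis .
  qed
  define M where "M = (1 / (1 - rp)) ^ J * (\<Sum>\<^sub>\<infinity>s\<in>Fseq. multinomial_term v s)"
  show ?thesis
  proof (rule nonneg_bdd_above_summable_on)
    show "bdd_above (sum (\<lambda>s. multinomial_term b s powr p) ` {F. F \<subseteq> Fseq \<and> finite F})"
    proof (rule bdd_aboveI2)
      fix F assume "F \<in> {F. F \<subseteq> Fseq \<and> finite F}"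
      then have F: "F \<subseteq> Fseq" "finite F" by auto
      have inj: "inj_on (\<lambda>s. (head s, rest s)) F"
      proof (rule inj_onI)
        fix s t assume "(head s, rest s) = (head t, rest t)"
        then have eq: "head s j = head t j" "rest s j = rest t j" for j by auto
        have "s j = t j" for j using eq[of j] by (auto simp: head_def rest_def split: if_splits)
        then show "s = t" by auto
      qed
      have "(\<Sum>s\<in>F. multinomial_term b s powr p)
          \<le> (\<Sum>s\<in>F. rp ^ snorm1 (head s) * multinomial_term v (rest s))"
        using F by (intro sum_mono term_le) auto
      also have "\<dots> = (\<Sum>(t, u)\<in>(\<lambda>s. (head s, rest s)) ` F. rp ^ snorm1 t * multinomial_term v u)"
        using inj by (simp add: sum.reindex)
      also have "\<dots> \<le> (\<Sum>(t, u)\<in>head ` F \<times> rest ` F. rp ^ snorm1 t * multinomial_term v u)"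
        using F rp v by (intro sum_mono2) (auto intro!: mult_nonneg_nonneg multinomial_term_nonneg)
      also have "\<dots> = (\<Sum>t\<in>head ` F. rp ^ snorm1 t) * (\<Sum>u\<in>rest ` F. multinomial_term v u)"
        by (simp add: sum_product sum.cartesian_product)
      also have "\<dots> \<le> M"
        unfolding M_def
      proof (intro mult_mono)
        show "(\<Sum>t\<in>head ` F. rp ^ snorm1 t) \<le> (1 / (1 - rp)) ^ J"
          using F rp by (intro sum_power_snorm1_le) (auto simp: head_def supp_def split: if_splits)
        show "(\<Sum>u\<in>rest ` F. multinomial_term v u) \<le> (\<Sum>\<^sub>\<infinity>s\<in>Fseq. multinomial_term v s)"
          using F Frest v tail by (intro finite_sum_le_infsum) (auto intro!: multinomial_term_nonneg)
      qed (use rp v in \<open>auto intro!: sum_nonneg multinomial_term_nonneg\<close>)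
      finally show "(\<Sum>s\<in>F. multinomial_term b s powr p) \<le> M" .
    qed
  qed auto
qed

section \<open>Legendre polynomials and exponentials in one variable\<close>

definition unif :: "real measure" where
  "unif = uniform_measure (restrict_space lborel {-1..1}) {-1..1}"

definition circ :: "real measure" where
  "circ = restrict_space lborel {0..<1}"

lemma space_unif [simp]: "space unif = {-1..1}"
  by (simp add: unif_def space_restrict_space)

lemma space_circ [simp]: "space circ = {0..<1}"
  by (simp add: circ_def space_restrict_space)

lemma emeasure_interval: "emeasure (restrict_space lborel {-1..1}) {-1..1::real} = 2"
  by (simp add: emeasure_restrict_space)

lemma unif_eq_density: "unif = density (restrict_space lborel {-1..1}) (\<lambda>_. ennreal (1 / 2))"
  unfolding unif_def uniform_measure_def emeasure_interval
proof (rule density_cong)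
  show "(\<lambda>t. indicator {-1..1} t / (2::ennreal)) \<in> borel_measurable (restrict_space lborel {-1..1::real})"
    by (intro borel_measurable_divide_ennreal measurable_restrict_space1) auto
  have half: "(1::ennreal) / 2 = ennreal (1 / 2)" using divide_ennreal[of 1 2] by simp
  show "AE t in restrict_space lborel {-1..1::real}. indicator {-1..1} t / 2 = ennreal (1 / 2)"
  proof (rule AE_I2)
    fix t assume "t \<in> space (restrict_space lborel {-1..1::real})"
    then have "indicator {-1..1} t = (1::ennreal)" by (simp add: space_restrict_space)
    then show "indicator {-1..1} t / 2 = ennreal (1 / 2)" by (simp only: half)
  qed
qed auto

lemma prob_space_unif: "prob_space unif"
  unfolding unif_def by (rule prob_space_uniform_measure) (auto simp: emeasure_interval)

lemma prob_space_circ: "prob_space circ"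
  unfolding circ_def by (rule prob_spaceI) (simp add: space_restrict_space emeasure_restrict_space)

interpretation unif: prob_space unif by (rule prob_space_unif)
interpretation circ: prob_space circ by (rule prob_space_circ)

lemma measure_unif_space [simp]: "measure unif {-1..1} = 1"
  using unif.prob_space by simp

lemma measure_circ_space [simp]: "measure circ {0..<1} = 1"
  using circ.prob_space by simp

lemma measurable_unif: "f \<in> borel_measurable borel \<Longrightarrow> f \<in> borel_measurable unif"
  unfolding unif_eq_density by (simp add: measurable_restrict_space1)

lemma measurable_circ: "f \<in> borel_measurable borel \<Longrightarrow> f \<in> borel_measurable circ"
  unfolding circ_def by (simp add: measurable_restrict_space1)

lemma integral_unif_derivative:
  fixes f F :: "real \<Rightarrow> real"
  assumes "\<And>t. (F has_real_derivative f t) (at t)" and f: "continuous_on UNIV f"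
  shows "(LINT t|unif. f t) = (F 1 - F (-1)) / 2"
proof -
  have m: "f \<in> borel_measurable borel" using f by (rule borel_measurable_continuous_onI)
  have "(LINT t|unif. f t) = (LINT t|restrict_space lborel {-1..1}. (1/2) *\<^sub>R f t)"
    unfolding unif_eq_density using m by (intro integral_density) (auto simp: measurable_restrict_space1)
  also have "\<dots> = (1/2) * (LINT t|lborel. indicator {-1..1} t *\<^sub>R f t)"
    by (simp add: integral_restrict_space)
  also have "(LINT t|lborel. indicator {-1..1} t *\<^sub>R f t) = F 1 - F (-1)"
    using assms
    by (intro integral_FTC_Icc)
       (auto simp: has_real_derivative_iff_has_vector_derivative[symmetric]
             intro: has_field_derivative_at_within continuous_on_subset)
  finally show ?thesis by simp
qed

lemma integral_circ_derivative:
  fixes f F :: "real \<Rightarrow> complex"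
  assumes "\<And>t. (F has_vector_derivative f t) (at t)" and f: "continuous_on UNIV f"
  shows "(LINT t|circ. f t) = F 1 - F 0"
proof -
  have m: "f \<in> borel_measurable borel" using f by (rule borel_measurable_continuous_onI)
  have "(LINT t|circ. f t) = (LINT t|lborel. indicator {0..<1} t *\<^sub>R f t)"
    by (simp add: integral_restrict_space circ_def)
  also have "\<dots> = (LINT t|lborel. indicator {0..1} t *\<^sub>R f t)"
  proof (rule integral_cong_AE)
    show "AE t in lborel. indicator {0..<1} t *\<^sub>R f t = indicator {0..1} t *\<^sub>R f t"
      using AE_lborel_singleton[of "1::real"] by eventually_elim (auto simp: indicator_def)
  qed (use m in measurable)
  also have "\<dots> = F 1 - F 0"
    using assms
    by (intro integral_FTC_Icc)
       (auto intro: has_vector_derivative_at_within continuous_on_subset)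
  finally show ?thesis .
qed

lemma integral_circ_exp:
  fixes k :: int
  shows "(LINT t|circ. exp (2 * of_real pi * \<i> * of_int k * of_real t)) = (if k = 0 then 1 else 0)"
proof (cases "k = 0")
  case True
  then show ?thesis by simp
next
  case False
  define c where "c = 2 * of_real pi * \<i> * of_int k"
  have c: "c \<noteq> 0" using False by (simp add: c_def)
  have "(LINT t|circ. exp (c * of_real t)) = exp (c * of_real 1) / c - exp (c * of_real 0) / c"
  proof (rule integral_circ_derivative)
    fix t :: real
    have "((\<lambda>z. exp (c * z) / c) has_field_derivative exp (c * of_real t)) (at (of_real t))"
      using c by (auto intro!: derivative_eq_intros)
    from has_vector_derivative_real_field[OF this]
    show "((\<lambda>t. exp (c * of_real t) / c) has_vector_derivative exp (c * of_real t)) (at t)"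
      by simp
  qed (intro continuous_intros)
  also have "\<dots> = 0"
    unfolding c_def using exp_integer_2pi[of "of_int k"] by (simp add: mult_ac)
  finally show ?thesis using False by (simp add: c_def)
qed

lemma poly_bounded_on_interval:
  fixes p :: "real poly"
  shows "\<exists>C\<ge>0. \<forall>t\<in>{-1..1}. \<bar>poly p t\<bar> \<le> C"
proof -
  have "compact (poly p ` {-1..1})"
    by (intro compact_continuous_image continuous_intros compact_Icc)
  then have "bounded (poly p ` {-1..1})" by (rule compact_imp_bounded)
  then obtain C where "\<forall>t\<in>{-1..1}. \<bar>poly p t\<bar> \<le> C" by (auto simp: bounded_iff)
  then show ?thesis by (intro exI[of _ "max C 0"]) force
qed

lemma poly_measurable [measurable]: "poly (p::real poly) \<in> borel_measurable borel"
  by (intro borel_measurable_continuous_onI continuous_intros)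

lemma integrable_unif_poly: "integrable unif (poly p)"
proof -
  obtain C where "\<forall>t\<in>{-1..1}. \<bar>poly p t\<bar> \<le> C" using poly_bounded_on_interval by blast
  then show ?thesis
    by (intro unif.integrable_const_bound[of _ C]) (auto intro: measurable_unif)
qed

definition poly_mean :: "real poly \<Rightarrow> real" where
  "poly_mean p = (LINT t|unif. poly p t)"

lemma poly_mean_add: "poly_mean (p + q) = poly_mean p + poly_mean q"
  by (simp add: poly_mean_def integrable_unif_poly)

lemma poly_mean_smult: "poly_mean (smult c p) = c * poly_mean p"
  by (simp add: poly_mean_def)

lemma poly_mean_1: "poly_mean 1 = 1"
  by (simp add: poly_mean_def)

lemma poly_mean_pderiv: "poly_mean (pderiv p) = (poly p 1 - poly p (-1)) / 2"
  unfolding poly_mean_def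
  by (rule integral_unif_derivative) (auto intro!: poly_DERIV continuous_intros)

lemma poly_mean_by_parts:
  assumes "poly p 1 = 0" "poly p (-1) = 0"
  shows "poly_mean (pderiv p * q) = - poly_mean (p * pderiv q)"
proof -
  have "poly_mean (pderiv (p * q)) = 0"
    unfolding poly_mean_pderiv by (simp add: assms)
  then show ?thesis by (simp add: pderiv_mult poly_mean_add mult.commute)
qed

definition rodrigues_base :: "nat \<Rightarrow> real poly" where
  "rodrigues_base n = [:-1, 0, 1:] ^ n"

lemma power_dvd_pderiv:
  fixes a p :: "real poly"
  assumes "a ^ Suc k dvd p"
  shows "a ^ k dvd pderiv p"
proof -
  obtain r where p: "p = a ^ Suc k * r" using assms by (elim dvdE)
  have "pderiv p = a ^ Suc k * pderiv r + r * (smult (of_nat (Suc k)) (a ^ k) * pderiv a)"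
    unfolding p pderiv_mult pderiv_power_Suc ..
  also have "\<dots> = a ^ k * (a * pderiv r + r * smult (of_nat (Suc k)) (pderiv a))"
    by (simp add: algebra_simps del: of_nat_Suc)
  finally show ?thesis by simp
qed

lemma power_dvd_higher_pderiv:
  fixes a p :: "real poly"
  assumes "a ^ n dvd p" "i \<le> n"
  shows "a ^ (n - i) dvd (pderiv ^^ i) p"
  using assms(2)
proof (induction i)
  case (Suc i)
  then have "a ^ Suc (n - Suc i) dvd (pderiv ^^ i) p" by (simp add: Suc_diff_Suc)
  then show ?case using power_dvd_pderiv by simp
qed (use assms in simp)

lemma higher_pderiv_rodrigues_base_boundary:
  assumes "i < n" and t: "t = 1 \<or> t = -1"
  shows "poly ((pderiv ^^ i) (rodrigues_base n)) t = 0"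
proof -
  have "[:-1, 0, 1:] = [:-t, 1:] * [:t, 1:]" using t by auto
  then have "[:-t, 1:] ^ n dvd rodrigues_base n"
    unfolding rodrigues_base_def by (simp only: power_mult_distrib dvd_triv_left)
  from power_dvd_higher_pderiv[OF this, of i] assms(1)
  have "[:-t, 1:] ^ (n - i) dvd (pderiv ^^ i) (rodrigues_base n)" by simp
  moreover have "[:-t, 1:] dvd [:-t, 1:] ^ (n - i)" using assms(1) by (intro dvd_power) simp
  ultimately show ?thesis using dvd_trans poly_eq_0_iff_dvd by blast
qed

text \<open>Each of the \<open>n\<close> integrations by parts is free of boundary terms because \<open>(t\<^sup>2 - 1) ^ n\<close> vanishes to
  order \<open>n\<close> at both endpoints.\<close>

lemma poly_mean_rodrigues:
  "poly_mean ((pderiv ^^ n) (rodrigues_base n) * q)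
    = (-1) ^ n * poly_mean (rodrigues_base n * (pderiv ^^ n) q)"
proof -
  have "poly_mean ((pderiv ^^ n) (rodrigues_base n) * q)
      = (-1) ^ i * poly_mean ((pderiv ^^ (n - i)) (rodrigues_base n) * (pderiv ^^ i) q)"
    if "i \<le> n" for i
    using that
  proof (induction i)
    case (Suc i)
    define p where "p = (pderiv ^^ (n - Suc i)) (rodrigues_base n)"
    have "(pderiv ^^ (n - i)) (rodrigues_base n) = pderiv p"
      using Suc.prems by (simp add: p_def Suc_diff_Suc[symmetric])
    moreover have "poly_mean (pderiv p * (pderiv ^^ i) q) = - poly_mean (p * pderiv ((pderiv ^^ i) q))"
      unfolding p_def using Suc.prems
      by (intro poly_mean_by_parts higher_pderiv_rodrigues_base_boundary) auto
    ultimately show ?case using Suc by (simp add: p_def)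
  qed simp
  from this[of n] show ?thesis by simp
qed

lemma degree_rodrigues_base: "degree (rodrigues_base n) = 2 * n"
  by (simp add: rodrigues_base_def degree_power_eq)

lemma lead_coeff_rodrigues_base: "coeff (rodrigues_base n) (2 * n) = 1"
  using lead_coeff_power[of "[:-1, 0, 1::real:]" n] degree_rodrigues_base[of n]
  by (simp add: rodrigues_base_def)

lemma higher_pderiv_rodrigues_base_full:
  "(pderiv ^^ (2 * n)) (rodrigues_base n) = [:fact (2 * n):]"
proof -
  have "degree ((pderiv ^^ (2 * n)) (rodrigues_base n)) = 0"
    by (simp add: degree_higher_pderiv degree_rodrigues_base)
  then have "(pderiv ^^ (2 * n)) (rodrigues_base n) = [:coeff ((pderiv ^^ (2 * n)) (rodrigues_base n)) 0:]"
    by (metis degree_0_id)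
  also have "coeff ((pderiv ^^ (2 * n)) (rodrigues_base n)) 0 = fact (2 * n)"
    by (simp add: coeff_higher_pderiv lead_coeff_rodrigues_base pochhammer_fact)
  finally show ?thesis .
qed

lemma higher_pderiv_eq_0:
  fixes p :: "real poly"
  assumes "degree p < n"
  shows "(pderiv ^^ n) p = 0"
  by (rule poly_eqI) (use assms in \<open>simp add: coeff_higher_pderiv coeff_eq_0\<close>)

text \<open>The polynomial \<open>t (t\<^sup>2 - 1) ^ (n + 1)\<close> vanishes at both endpoints, so its derivative has mean 0; as
  \<open>2 t\<^sup>2 = 2 (t\<^sup>2 - 1) + 2\<close>, that is a recursion for the means.\<close>

lemma poly_mean_rodrigues_base:
  "poly_mean (rodrigues_base n) = (-1) ^ n * (4 ^ n * (fact n)\<^sup>2 / fact (2 * n + 1))"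
proof (induction n)
  case 0
  then show ?case by (simp add: rodrigues_base_def poly_mean_1)
next
  case (Suc n)
  let ?W = rodrigues_base
  have "pderiv ([:0, 1:] * ?W (Suc n))
      = ?W (Suc n) + smult (of_nat (Suc n)) ([:0, 1:] * [:0, 2:] * ?W n)"
    unfolding pderiv_mult rodrigues_base_def pderiv_power_Suc
    by (simp add: pderiv_pCons algebra_simps del: of_nat_Suc power_Suc)
  also have "[:0, 1:] * [:0, 2:] * ?W n = smult 2 (?W (Suc n) + ?W n)"
  proof -
    have "[:0, 1:] * [:0, 2:] = smult 2 ([:-1, 0, 1:] + 1 :: real poly)"
      by (simp add: one_pCons)
    then show ?thesis by (simp add: rodrigues_base_def algebra_simps smult_add_right)
  qed
  finally have eq: "pderiv ([:0, 1:] * ?W (Suc n))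
      = ?W (Suc n) + smult (of_nat (Suc n)) (smult 2 (?W (Suc n) + ?W n))" .
  have "poly_mean (pderiv ([:0, 1:] * ?W (Suc n))) = 0"
    unfolding poly_mean_pderiv by (simp add: rodrigues_base_def)
  then have "(2 * real n + 3) * poly_mean (?W (Suc n)) = - (2 * (real n + 1)) * poly_mean (?W n)"
    unfolding eq poly_mean_add poly_mean_smult by (simp add: algebra_simps)
  then have "poly_mean (?W (Suc n)) = - (2 * (real n + 1)) / (2 * real n + 3) * poly_mean (?W n)"
    by (simp add: field_simps)
  also have "\<dots> = (-1) ^ Suc n * (4 ^ n * (fact n)\<^sup>2 / fact (2 * n + 1)
      * (2 * (real n + 1) / (2 * real n + 3)))"
  proof -
    have "- a / c * (e * x) = (-1) * e * (x * (a / c))" for a c e x :: real by simp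
    then show ?thesis unfolding Suc.IH power_Suc .
  qed
  also have "4 ^ n * (fact n)\<^sup>2 / fact (2 * n + 1) * (2 * (real n + 1) / (2 * real n + 3))
      = 4 ^ Suc n * (fact (Suc n))\<^sup>2 / (fact (2 * Suc n + 1) :: real)"
  proof -
    have f: "fact (2 * Suc n + 1) = (2 * real n + 3) * ((2 * real n + 2) * fact (2 * n + 1))"
      by (simp add: algebra_simps)
    have "(2 * real n + 3) \<noteq> 0" "(2 * real n + 2) \<noteq> 0" by auto
    then show ?thesis unfolding f
      by (simp add: divide_simps power2_eq_square) (simp add: algebra_simps)
  qed
  finally show ?case .
qed

text \<open>For \<open>k < n\<close> the \<open>n\<close> derivatives that are moved onto the polynomial of degree \<open>k\<close> annihilate it. For
  \<open>k = n\<close> they leave the constant \<open>(2 n)!\<close> and the mean of \<open>(t\<^sup>2 - 1) ^ n\<close>.\<close>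

lemma legendre_orthonormal:
  "(LINT t|unif. poly (legendre n) t * poly (legendre k) t) = (if n = k then 1 else 0)"
proof -
  have less: "poly_mean (legendre n * legendre k) = 0" if "k < n" for n k
  proof -
    have "(pderiv ^^ n) ((pderiv ^^ k) (rodrigues_base k)) = 0"
      using that by (intro higher_pderiv_eq_0) (simp add: degree_higher_pderiv degree_rodrigues_base)
    then have "poly_mean ((pderiv ^^ n) (rodrigues_base n) * (pderiv ^^ k) (rodrigues_base k)) = 0"
      unfolding poly_mean_rodrigues by (simp add: poly_mean_def)
    then show ?thesis
      by (simp add: legendre_def rodrigues_base_def poly_mean_smult)
  qed
  have eq: "poly_mean (legendre n * legendre n) = 1"
  proof -
    have "poly_mean ((pderiv ^^ n) (rodrigues_base n) * (pderiv ^^ n) (rodrigues_base n))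
        = (-1) ^ n * poly_mean (rodrigues_base n * (pderiv ^^ (2 * n)) (rodrigues_base n))"
      unfolding poly_mean_rodrigues by (simp add: mult_2 funpow_add)
    also have "\<dots> = (-1) ^ n * (fact (2 * n) * poly_mean (rodrigues_base n))"
      unfolding higher_pderiv_rodrigues_base_full by (simp add: poly_mean_smult)
    also have "\<dots> = fact (2 * n) * (4 ^ n * (fact n)\<^sup>2 / fact (2 * n + 1))"
      unfolding poly_mean_rodrigues_base by (simp add: power_mult_distrib[symmetric])
    also have "\<dots> = 4 ^ n * (fact n)\<^sup>2 / (2 * real n + 1)"
    proof -
      have "fact (2 * n + 1) = (2 * real n + 1) * fact (2 * n)" by simp
      then show ?thesis by (simp only:) simp
    qed
    finally have *: "poly_mean ((pderiv ^^ n) (rodrigues_base n) * (pderiv ^^ n) (rodrigues_base n))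
        = 4 ^ n * (fact n)\<^sup>2 / (2 * real n + 1)" .
    have "poly_mean (legendre n * legendre n) = (sqrt (2 * real n + 1) / (2 ^ n * fact n))\<^sup>2
        * (4 ^ n * (fact n)\<^sup>2 / (2 * real n + 1))"
      unfolding *[symmetric] legendre_def rodrigues_base_def[symmetric]
      by (simp add: poly_mean_smult power2_eq_square)
    also have "\<dots> = 1"
      by (simp add: power_divide power_mult_distrib power_mult[symmetric] mult.commute[of n 2] power_mult)
    finally show ?thesis .
  qed
  have "poly_mean (legendre n * legendre k) = (if n = k then 1 else 0)"
    using less[of n k] less[of k n] eq by (cases n k rule: linorder_cases) (auto simp: mult.commute)
  then show ?thesis by (simp add: poly_mean_def)
qed

lemma legendre_0: "legendre 0 = 1"
  by (simp add: legendre_def)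

section \<open>Orthonormality on the torus times the cube\<close>

lemma cube_eq: "cube = Pi\<^sub>M UNIV (\<lambda>_. unif)"
  by (simp add: cube_def unif_def)

lemma torus_eq: "torus m = Pi\<^sub>M {..<m} (\<lambda>_. circ)"
  by (simp add: torus_def circ_def)

lemma prob_space_cube: "prob_space cube"
  unfolding cube_eq by (intro prob_space_PiM prob_space_unif)

lemma prob_space_torus: "prob_space (torus m)"
  unfolding torus_eq by (intro prob_space_PiM prob_space_circ)

interpretation cube: prob_space cube by (rule prob_space_cube)
interpretation torus: prob_space "torus m" for m by (rule prob_space_torus)
interpretation TI: pair_prob_space "torus m" cube for m ..

lemma prob_space_TI: "prob_space (TI m)"
  unfolding TI_def by (rule TI.prob_space_axioms)

interpretation TIm: prob_space "TI m" for m by (rule prob_space_TI)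

lemma space_cube: "y \<in> space cube \<longleftrightarrow> (\<forall>j. y j \<in> {-1..1})"
  by (auto simp: cube_eq space_PiM PiE_UNIV_domain)

lemma space_TI: "space (TI m) = space (torus m) \<times> space cube"
  by (simp add: TI_def space_pair_measure)

lemma cube_update_measurable:
  "(\<lambda>(t, y). y(j := t)) \<in> measurable (unif \<Otimes>\<^sub>M cube) cube"
proof -
  have "(\<lambda>p. (snd p)(j := fst p)) \<in> measurable (unif \<Otimes>\<^sub>M Pi\<^sub>M UNIV (\<lambda>_. unif)) (Pi\<^sub>M UNIV (\<lambda>_. unif))"
    by (rule measurable_fun_upd[where J = UNIV]) auto
  then show ?thesis by (simp add: cube_eq case_prod_beta')
qed

text \<open>Replacing the coordinate \<open>j\<close> by an independent uniform variable preserves the measure of the cube, so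
  Fubini's theorem separates \<open>g\<close> from any function \<open>h\<close> that ignores this coordinate. Since \<open>h\<close> may
  depend on all the other coordinates, this applies to arbitrary square integrable functions as well
  as to finite products.\<close>

lemma cube_integral_split:
  fixes h :: "(nat \<Rightarrow> real) \<Rightarrow> 'b::{real_normed_field, banach, second_countable_topology}"
    and g :: "real \<Rightarrow> 'b"
  assumes int: "integrable cube (\<lambda>y. h y * g (y j))"
    and h: "\<And>y t. y \<in> space cube \<Longrightarrow> t \<in> {-1..1} \<Longrightarrow> h (y(j := t)) = h y"
  shows "(LINT y|cube. h y * g (y j)) = (LINT y|cube. h y) * (LINT t|unif. g t)"
proof -
  interpret P: pair_sigma_finite unif cube ..
  let ?F = "\<lambda>y. h y * g (y j)"
  let ?u = "\<lambda>(t, y). y(j := t)"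
  have D: "distr (unif \<Otimes>\<^sub>M cube) cube ?u = cube"
    using distr_pair_PiM_eq_PiM[of UNIV "\<lambda>_. unif" j] prob_space_unif by (simp add: cube_eq)
  have m: "?F \<in> borel_measurable cube" using int by simp
  note u = cube_update_measurable[of j]
  have int': "integrable (unif \<Otimes>\<^sub>M cube) (\<lambda>p. ?F (?u p))"
    using integrable_distr_eq[OF u m] int unfolding D by simp
  have eq: "?F (?u p) = h (snd p) * g (fst p)" if "p \<in> space (unif \<Otimes>\<^sub>M cube)" for p
    using that h by (auto simp: space_pair_measure)
  have "(LINT y|cube. ?F y) = (LINT p|(unif \<Otimes>\<^sub>M cube). ?F (?u p))"
    using integral_distr[OF u m] unfolding D .
  also have "\<dots> = (LINT p|(unif \<Otimes>\<^sub>M cube). h (snd p) * g (fst p))"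
    by (intro Bochner_Integration.integral_cong refl eq)
  also have "\<dots> = (LINT p|(unif \<Otimes>\<^sub>M cube). case_prod (\<lambda>t y. h y * g t) p)"
    by (simp add: case_prod_beta')
  also have "\<dots> = (LINT y|cube. (LINT t|unif. h y * g t))"
  proof (rule P.integral_snd[symmetric])
    show "integrable (unif \<Otimes>\<^sub>M cube) (case_prod (\<lambda>t y. h y * g t))"
      using int' by (rule Bochner_Integration.integrable_cong[THEN iffD1, rotated 2])
        (auto simp: h space_pair_measure case_prod_beta')
  qed
  also have "\<dots> = (LINT y|cube. h y) * (LINT t|unif. g t)" by simp
  finally show ?thesis .
qed

lemma cube_component_measurable:
  "f \<in> borel_measurable borel \<Longrightarrow> (\<lambda>y. f (y j)) \<in> borel_measurable cube"
  unfolding cube_eq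
  by (rule measurable_compose[of "\<lambda>y. y j" _ unif f]) (auto intro: measurable_unif)

lemma cube_prod_bounded:
  fixes p :: "nat \<Rightarrow> real poly"
  shows "\<exists>C\<ge>0. \<forall>y\<in>space cube. \<bar>(\<Prod>j\<in>A. poly (p j) (y j))\<bar> \<le> C"
proof -
  obtain C where C: "0 \<le> C j" "\<And>t. t \<in> {-1..1} \<Longrightarrow> \<bar>poly (p j) t\<bar> \<le> C j" for j
    using poly_bounded_on_interval[of "p _"] by metis
  have "\<bar>(\<Prod>j\<in>A. poly (p j) (y j))\<bar> \<le> (\<Prod>j\<in>A. C j)" if "y \<in> space cube" for y
    unfolding abs_prod using that C(2) by (intro prod_mono) (auto simp: space_cube)
  then show ?thesis using C(1) by (intro exI[of _ "prod C A"]) (auto intro: prod_nonneg)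
qed

lemma cube_prod_integrable:
  fixes p :: "nat \<Rightarrow> real poly"
  shows "integrable cube (\<lambda>y. \<Prod>j\<in>A. poly (p j) (y j))"
proof -
  obtain C where "\<forall>y\<in>space cube. \<bar>(\<Prod>j\<in>A. poly (p j) (y j))\<bar> \<le> C"
    using cube_prod_bounded[where p = p and A = A] by blast
  then show ?thesis
    by (intro cube.integrable_const_bound[of _ C]) (auto intro!: borel_measurable_prod cube_component_measurable poly_measurable)
qed

lemma cube_integral_prod:
  fixes p :: "nat \<Rightarrow> real poly"
  assumes "finite A"
  shows "(LINT y|cube. (\<Prod>j\<in>A. poly (p j) (y j))) = (\<Prod>j\<in>A. poly_mean (p j))"
  using assms
proof induction
  case empty
  then show ?case by (simp add: cube.prob_space)
next
  case (insert i A)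
  have eq: "(\<lambda>y. \<Prod>j\<in>insert i A. poly (p j) (y j)) = (\<lambda>y. (\<Prod>j\<in>A. poly (p j) (y j)) * poly (p i) (y i))"
    using insert by (simp add: mult.commute)
  have "(LINT y|cube. (\<Prod>j\<in>A. poly (p j) (y j)) * poly (p i) (y i))
      = (LINT y|cube. (\<Prod>j\<in>A. poly (p j) (y j))) * poly_mean (p i)"
    unfolding poly_mean_def
  proof (rule cube_integral_split)
    show "integrable cube (\<lambda>y. (\<Prod>j\<in>A. poly (p j) (y j)) * poly (p i) (y i))"
      unfolding eq[symmetric] by (rule cube_prod_integrable)
    show "(\<Prod>j\<in>A. poly (p j) ((y(i := t)) j)) = (\<Prod>j\<in>A. poly (p j) (y j))" for y t
      using insert(2) by (intro prod.cong) auto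
  qed
  then show ?case unfolding eq insert.IH using insert by (simp add: mult.commute)
qed

lemma Lpoly_eq_prod:
  assumes "finite A" "supp s \<subseteq> A"
  shows "Lpoly s y = (\<Prod>j\<in>A. poly (legendre (s j)) (y j))"
  unfolding Lpoly_def using assms
  by (intro prod.mono_neutral_left) (auto simp: supp_def legendre_0)

lemma Lpoly_orthonormal:
  assumes "s \<in> Fseq" "t \<in> Fseq"
  shows "(LINT y|cube. Lpoly s y * Lpoly t y) = (if s = t then 1 else 0)"
proof -
  define A where "A = supp s \<union> supp t"
  have A: "finite A" "supp s \<subseteq> A" "supp t \<subseteq> A" using assms by (auto simp: A_def Fseq_iff)
  have "(LINT y|cube. Lpoly s y * Lpoly t y)
      = (LINT y|cube. (\<Prod>j\<in>A. poly (legendre (s j) * legendre (t j)) (y j)))"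
    unfolding Lpoly_eq_prod[OF A(1,2)] Lpoly_eq_prod[OF A(1,3)] by (simp add: prod.distrib)
  also have "\<dots> = (\<Prod>j\<in>A. if s j = t j then 1 else 0)"
    unfolding cube_integral_prod[OF A(1)] by (simp add: poly_mean_def legendre_orthonormal)
  also have "\<dots> = (if s = t then 1 else 0)"
  proof (cases "s = t")
    case False
    then obtain j where j: "s j \<noteq> t j" by auto
    then have "j \<in> A" by (auto simp: A_def supp_def)
    then show ?thesis using A(1) False j by (auto simp: prod_zero_iff)
  qed simp
  finally show ?thesis .
qed

lemma cnj_measurable [measurable]: "cnj \<in> borel_measurable borel"
  by (intro borel_measurable_continuous_onI continuous_intros)

lemma torus_component_measurable:
  "f \<in> borel_measurable borel \<Longrightarrow> j < m \<Longrightarrow> (\<lambda>x. f (x j)) \<in> borel_measurable (torus m)"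
  unfolding torus_eq
  by (rule measurable_compose[of "\<lambda>x. x j" _ circ f]) (auto intro: measurable_circ)

lemma norm_efun: "cmod (efun m k x) = 1"
  unfolding efun_def prod_norm[symmetric] by (intro prod.neutral) simp

lemma efun_measurable [measurable]: "efun m k \<in> borel_measurable (torus m)"
proof -
  have "(\<lambda>t. exp (2 * of_real pi * \<i> * of_int (k j) * of_real t)) \<in> borel_measurable borel" for j
    by (intro borel_measurable_continuous_onI continuous_intros)
  then have "(\<lambda>x. \<Prod>j<m. exp (2 * of_real pi * \<i> * of_int (k j) * of_real (x j))) \<in> borel_measurable (torus m)"
    by (intro borel_measurable_prod torus_component_measurable) auto
  then show ?thesis by (simp add: efun_def[abs_def])
qed

lemma efun_orthonormal:
  assumes "k \<in> Zstar m" "l \<in> Zstar m"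
  shows "(LINT x|torus m. efun m k x * cnj (efun m l x)) = (if k = l then 1 else 0)"
proof -
  interpret product_sigma_finite "\<lambda>_::nat. circ" ..
  let ?f = "\<lambda>j t. exp (2 * of_real pi * \<i> * of_int (k j - l j) * of_real t)"
  have "efun m k x * cnj (efun m l x) = (\<Prod>j<m. ?f j (x j))" for x
    unfolding efun_def cnj_prod prod.distrib[symmetric]
    by (intro prod.cong refl) (simp add: exp_cnj exp_add[symmetric] algebra_simps)
  then have "(LINT x|torus m. efun m k x * cnj (efun m l x)) = (\<Prod>j<m. LINT t|circ. ?f j t)"
    unfolding torus_eq
  proof (simp only:, intro product_integral_prod)
    fix j
    show "integrable circ (?f j)"
      by (intro circ.integrable_const_bound[of _ 1] AE_I2 measurable_circ
          borel_measurable_continuous_onI continuous_intros) simp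
  qed auto
  also have "\<dots> = (\<Prod>j<m. if k j = l j then 1 else 0)"
    unfolding integral_circ_exp by simp
  also have "\<dots> = (if k = l then 1 else 0)"
  proof (cases "k = l")
    case False
    then obtain j where j: "k j \<noteq> l j" by auto
    then have "j < m" using assms unfolding Zstar_def by (metis PiE_E lessThan_iff)
    then show ?thesis using j False by (auto simp: prod_zero_iff)
  qed simp
  finally show ?thesis .
qed

lemma Lpoly_measurable [measurable]: "Lpoly s \<in> borel_measurable cube"
  unfolding Lpoly_def[abs_def]
  by (rule borel_measurable_prod, rule cube_component_measurable, rule poly_measurable)

lemma Lfun_measurable [measurable]: "Lfun m ks \<in> borel_measurable (TI m)"
proof -
  obtain k s where ks: "ks = (k, s)" by (cases ks)
  have "(\<lambda>z. efun m k (fst z)) \<in> borel_measurable (TI m)"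
    unfolding TI_def by (rule measurable_compose[OF measurable_fst efun_measurable])
  moreover have "(\<lambda>z. Lpoly s (snd z)) \<in> borel_measurable (TI m)"
    unfolding TI_def by (rule measurable_compose[OF measurable_snd Lpoly_measurable])
  ultimately have "(\<lambda>z. efun m k (fst z) * of_real (Lpoly s (snd z))) \<in> borel_measurable (TI m)"
    by measurable
  then show ?thesis by (simp add: Lfun_def ks case_prod_beta')
qed

lemma Lfun_bounded: "\<exists>C\<ge>0. \<forall>z\<in>space (TI m). cmod (Lfun m ks z) \<le> C"
proof -
  obtain k s where ks: "ks = (k, s)" by (cases ks)
  obtain C where "C \<ge> 0" "\<forall>y\<in>space cube. \<bar>Lpoly s y\<bar> \<le> C"
    unfolding Lpoly_def using cube_prod_bounded[where A = "supp s" and p = "\<lambda>j. legendre (s j)"] by blast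
  then show ?thesis
    by (intro exI[of _ C]) (auto simp: ks Lfun_def space_TI norm_mult norm_efun)
qed

lemma Lfun_orthonormal:
  assumes "ks \<in> Zstar m \<times> Fseq" "lt \<in> Zstar m \<times> Fseq"
  shows "(LINT z|TI m. Lfun m ks z * cnj (Lfun m lt z)) = (if ks = lt then 1 else 0)"
proof -
  obtain k s l t where ks: "ks = (k, s)" and lt: "lt = (l, t)" by (cases ks, cases lt) auto
  have mem: "k \<in> Zstar m" "l \<in> Zstar m" "s \<in> Fseq" "t \<in> Fseq" using assms by (auto simp: ks lt)
  obtain C where C: "C \<ge> 0" "\<forall>z\<in>space (TI m). cmod (Lfun m ks z) \<le> C" using Lfun_bounded by blast
  obtain D where D: "D \<ge> 0" "\<forall>z\<in>space (TI m). cmod (Lfun m lt z) \<le> D" using Lfun_bounded by blast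
  have [measurable]: "(\<lambda>z. Lfun m ks z * cnj (Lfun m lt z)) \<in> borel_measurable (TI m)"
    by measurable
  have int: "integrable (TI m) (\<lambda>z. Lfun m ks z * cnj (Lfun m lt z))"
    by (intro TIm.integrable_const_bound[of _ "C * D"] AE_I2)
       (use C D in \<open>auto simp: norm_mult intro!: mult_mono\<close>)
  have "(LINT z|TI m. Lfun m ks z * cnj (Lfun m lt z))
      = (LINT x|torus m. (LINT y|cube. Lfun m ks (x, y) * cnj (Lfun m lt (x, y))))"
    using TI.integral_fst'[OF int[unfolded TI_def]] by (simp add: TI_def)
  also have "\<dots> = (LINT x|torus m. (efun m k x * cnj (efun m l x))
      * (LINT y|cube. of_real (Lpoly s y * Lpoly t y)))"
    by (subst integral_mult_right_zero[symmetric]) (simp add: ks lt Lfun_def mult_ac)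
  also have "\<dots> = (if k = l then 1 else 0) * (if s = t then 1 else 0)"
    unfolding integral_complex_of_real Lpoly_orthonormal[OF mem(3,4)]
    by (simp add: efun_orthonormal[OF mem(1,2)])
  finally show ?thesis by (simp add: ks lt)
qed

section \<open>Coefficients, partial sums and best approximation\<close>

abbreviation index_set :: "nat \<Rightarrow> ((nat \<Rightarrow> int) \<times> (nat \<Rightarrow> nat)) set" where
  "index_set m \<equiv> Zstar m \<times> Fseq"

lemma L2_bounded:
  assumes "v \<in> borel_measurable (TI m)" "\<And>z. z \<in> space (TI m) \<Longrightarrow> cmod (v z) \<le> C"
  shows "v \<in> L2 m"
proof -
  have "integrable (TI m) (\<lambda>z. (cmod (v z))\<^sup>2)"
    using assms by (intro TIm.integrable_const_bound[of _ "C\<^sup>2"] AE_I2) (auto intro: power_mono)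
  then show ?thesis using assms by (simp add: L2_def)
qed

lemma Lfun_L2: "Lfun m ks \<in> L2 m"
  using Lfun_bounded[of m ks] by (auto intro: L2_bounded)

lemma L2_subspace: "cfun.subspace (L2 m)"
proof (rule cfun.subspaceI)
  show "0 \<in> L2 m" by (simp add: L2_def zero_fun_def)
next
  fix v w assume v: "v \<in> L2 m" and w: "w \<in> L2 m"
  have meas [measurable]: "v \<in> borel_measurable (TI m)" "w \<in> borel_measurable (TI m)"
    using v w by (auto simp: L2_def)
  have "integrable (TI m) (\<lambda>z. (cmod (v z + w z))\<^sup>2)"
  proof (rule Bochner_Integration.integrable_bound)
    show "integrable (TI m) (\<lambda>z. 2 * (cmod (v z))\<^sup>2 + 2 * (cmod (w z))\<^sup>2)"
      using v w by (auto simp: L2_def)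
    have "(cmod (v z + w z))\<^sup>2 \<le> 2 * (cmod (v z))\<^sup>2 + 2 * (cmod (w z))\<^sup>2" for z
    proof -
      have "(cmod (v z + w z))\<^sup>2 \<le> (cmod (v z) + cmod (w z))\<^sup>2"
        by (intro power_mono norm_triangle_ineq) auto
      then show ?thesis
        using sum_squares_bound[of "cmod (v z)" "cmod (w z)"] by (simp add: power2_sum)
    qed
    then show "AE z in TI m. norm ((cmod (v z + w z))\<^sup>2) \<le> norm (2 * (cmod (v z))\<^sup>2 + 2 * (cmod (w z))\<^sup>2)"
      by (intro AE_I2) simp
  qed measurable
  moreover have "v + w \<in> borel_measurable (TI m)" unfolding plus_fun_def by measurable
  ultimately show "v + w \<in> L2 m" by (simp add: L2_def)
next
  fix c v assume "v \<in> L2 m"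
  then show "fun_scale c v \<in> L2 m"
    by (auto simp: L2_def fun_scale_def norm_mult power_mult_distrib)
qed

lemma integrable_mult_Lfun:
  assumes "v \<in> L2 m"
  shows "integrable (TI m) (\<lambda>z. v z * cnj (Lfun m ks z))"
proof -
  have [measurable]: "v \<in> borel_measurable (TI m)" using assms by (simp add: L2_def)
  obtain C where C: "C \<ge> 0" "\<forall>z\<in>space (TI m). cmod (Lfun m ks z) \<le> C" using Lfun_bounded by blast
  show ?thesis
  proof (rule Bochner_Integration.integrable_bound)
    show "integrable (TI m) (\<lambda>z. C * (1 + (cmod (v z))\<^sup>2))"
      using assms by (auto simp: L2_def)
    show "AE z in TI m. norm (v z * cnj (Lfun m ks z)) \<le> norm (C * (1 + (cmod (v z))\<^sup>2))"
    proof (rule AE_I2)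
      fix z assume "z \<in> space (TI m)"
      moreover have "cmod (v z) \<le> 1 + (cmod (v z))\<^sup>2"
      proof -
        have "2 * cmod (v z) \<le> (cmod (v z))\<^sup>2 + 1"
          using sum_squares_bound[of "cmod (v z)" 1] by simp
        moreover have "0 \<le> cmod (v z)" by simp
        ultimately show ?thesis by linarith
      qed
      ultimately have "cmod (v z) * cmod (Lfun m ks z) \<le> (1 + (cmod (v z))\<^sup>2) * C"
        using C by (intro mult_mono) auto
      then show "norm (v z * cnj (Lfun m ks z)) \<le> norm (C * (1 + (cmod (v z))\<^sup>2))"
        using C(1) by (simp add: norm_mult mult.commute)
    qed
  qed measurable
qed

definition Lcomb :: "nat \<Rightarrow> ((nat \<Rightarrow> int) \<times> (nat \<Rightarrow> nat)) set
    \<Rightarrow> ((nat \<Rightarrow> int) \<times> (nat \<Rightarrow> nat) \<Rightarrow> complex) \<Rightarrow> tifun" where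
  "Lcomb m G c = (\<lambda>z. \<Sum>ks\<in>G. c ks * Lfun m ks z)"

lemma Sop_eq_Lcomb: "Sop m G v = Lcomb m G (coef m v)"
  by (simp add: Sop_def Lcomb_def)

lemma Lcomb_eq_sum: "Lcomb m G c = (\<Sum>ks\<in>G. fun_scale (c ks) (Lfun m ks))"
proof (rule ext)
  have apply_sum: "(\<Sum>i\<in>G. f i) z = (\<Sum>i\<in>G. f i z)" for f :: "_ \<Rightarrow> tifun" and z
    by (induction G rule: infinite_finite_induct) auto
  show "Lcomb m G c z = (\<Sum>ks\<in>G. fun_scale (c ks) (Lfun m ks)) z" for z
    by (simp add: Lcomb_def fun_scale_def apply_sum)
qed

lemma Lcomb_in_Vspan: "Lcomb m G c \<in> Vspan m G"
  unfolding Lcomb_eq_sum Vspan_def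
  by (intro cfun.span_sum cfun.span_scale cfun.span_base) auto

lemma Vspan_imp_Lcomb:
  assumes "finite G" "g \<in> Vspan m G"
  shows "\<exists>c. g = Lcomb m G c"
proof -
  have "Vspan m G \<subseteq> range (Lcomb m G)"
    unfolding Vspan_def
  proof (rule cfun.span_minimal)
    show "Lfun m ` G \<subseteq> range (Lcomb m G)"
    proof
      fix f assume "f \<in> Lfun m ` G"
      then obtain ks where ks: "ks \<in> G" "f = Lfun m ks" by auto
      have "f = Lcomb m G (\<lambda>lt. if lt = ks then 1 else 0)"
        using assms(1) ks by (intro ext) (simp add: Lcomb_def if_distrib[of "\<lambda>x. x * _"] cong: if_cong)
      then show "f \<in> range (Lcomb m G)" by blast
    qed
    show "cfun.subspace (range (Lcomb m G))"
    proof (rule cfun.subspaceI)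
      have "0 = Lcomb m G (\<lambda>_. 0)" by (intro ext) (simp add: Lcomb_def)
      then show "0 \<in> range (Lcomb m G)" by blast
    next
      fix f g assume "f \<in> range (Lcomb m G)" "g \<in> range (Lcomb m G)"
      then obtain c d where "f = Lcomb m G c" "g = Lcomb m G d" by auto
      then have "f + g = Lcomb m G (\<lambda>ks. c ks + d ks)"
        by (intro ext) (simp add: Lcomb_def sum.distrib ring_distribs)
      then show "f + g \<in> range (Lcomb m G)" by blast
    next
      fix x f assume "f \<in> range (Lcomb m G)"
      then obtain c where "f = Lcomb m G c" by auto
      then have "fun_scale x f = Lcomb m G (\<lambda>ks. x * c ks)"
        by (intro ext) (simp add: Lcomb_def fun_scale_def sum_distrib_left mult.assoc)
      then show "fun_scale x f \<in> range (Lcomb m G)" by blast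
    qed
  qed
  then show ?thesis using assms(2) by blast
qed

lemma Lcomb_L2: "Lcomb m G c \<in> L2 m"
  unfolding Lcomb_eq_sum
  by (intro cfun.subspace_sum[OF L2_subspace] cfun.subspace_scale[OF L2_subspace] Lfun_L2)

lemma coef_diff:
  assumes "v \<in> L2 m" "w \<in> L2 m"
  shows "coef m (v - w) ks = coef m v ks - coef m w ks"
  using assms by (simp add: coef_def left_diff_distrib integrable_mult_Lfun)

lemma coef_Lcomb:
  assumes G: "finite G" "G \<subseteq> index_set m" and ks: "ks \<in> index_set m"
  shows "coef m (Lcomb m G c) ks = (if ks \<in> G then c ks else 0)"
proof -
  have "coef m (Lcomb m G c) ks = (LINT z|TI m. (\<Sum>lt\<in>G. c lt * (Lfun m lt z * cnj (Lfun m ks z))))"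
    by (simp add: coef_def Lcomb_def sum_distrib_right mult.assoc)
  also have "\<dots> = (\<Sum>lt\<in>G. c lt * (LINT z|TI m. Lfun m lt z * cnj (Lfun m ks z)))"
    by (subst Bochner_Integration.integral_sum) (auto intro!: integrable_mult_right integrable_mult_Lfun Lfun_L2)
  also have "\<dots> = (\<Sum>lt\<in>G. if lt = ks then c lt else 0)"
  proof (intro sum.cong refl)
    fix lt assume "lt \<in> G"
    then have "lt \<in> index_set m" using G(2) by blast
    then show "c lt * (LINT z|TI m. Lfun m lt z * cnj (Lfun m ks z)) = (if lt = ks then c lt else 0)"
      by (simp add: Lfun_orthonormal[OF _ ks])
  qed
  also have "\<dots> = (if ks \<in> G then c ks else 0)" using G(1) by (simp add: sum.delta)
  finally show ?thesis .
qed

definition K_weight :: "nat \<Rightarrow> real \<Rightarrow> (nat \<Rightarrow> int) \<times> (nat \<Rightarrow> nat) \<Rightarrow> real" where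
  "K_weight m \<beta> ks = real_of_int (knorm m (fst ks)) powr (2 * \<beta>)"

lemma K_norm_eq:
  "K_norm m \<beta> v = sqrt (\<Sum>\<^sub>\<infinity>ks\<in>index_set m. K_weight m \<beta> ks * (cmod (coef m v ks))\<^sup>2)"
  by (simp add: K_norm_def K_weight_def case_prod_beta')

text \<open>The partial sum of \<open>g\<close> over any finite set of indices that contains \<open>G\<close> is \<open>g\<close> itself, so the net of
  partial sums is eventually constant.\<close>

lemma Vspan_subset_K_space:
  assumes G: "finite G" "G \<subseteq> index_set m"
  shows "Vspan m G \<subseteq> K_space m \<beta>"
proof
  fix g assume "g \<in> Vspan m G"
  then obtain c where g: "g = Lcomb m G c" using Vspan_imp_Lcomb[OF G(1)] by blast
  have "is_Lseries m g"
    unfolding is_Lseries_def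
  proof (rule tendsto_eventually)
    have "L2_norm m (g - Sop m H g) = 0" if H: "finite H" "G \<subseteq> H" "H \<subseteq> index_set m" for H
    proof -
      have "Sop m H g = g"
      proof (rule ext)
        fix z
        have "Sop m H g z = (\<Sum>ks\<in>H. (if ks \<in> G then c ks else 0) * Lfun m ks z)"
          unfolding Sop_def g using H(3) by (intro sum.cong refl) (auto simp: coef_Lcomb[OF G])
        also have "\<dots> = (\<Sum>ks\<in>G. c ks * Lfun m ks z)"
          using H by (intro sum.mono_neutral_cong_right) auto
        finally show "Sop m H g z = g z" by (simp add: g Lcomb_def)
      qed
      then show ?thesis by (simp add: L2_norm_def)
    qed
    then show "\<forall>\<^sub>F H in finite_subsets_at_top (index_set m). L2_norm m (g - Sop m H g) = 0"
      unfolding eventually_finite_subsets_at_top using G by blast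
  qed
  moreover have "(\<lambda>ks. K_weight m \<beta> ks * (cmod (coef m g ks))\<^sup>2) summable_on index_set m"
    by (rule finite_nonzero_values_imp_summable_on, rule finite_subset[OF _ G(1)])
       (auto simp: g coef_Lcomb[OF G] split: if_splits)
  ultimately show "g \<in> K_space m \<beta>"
    by (simp add: K_space_def K_weight_def case_prod_beta' g Lcomb_L2)
qed

lemma summable_on_finite_change:
  fixes f g :: "'i \<Rightarrow> real"
  assumes f: "f summable_on A" and G: "finite G" and eq: "\<And>x. x \<in> A - G \<Longrightarrow> g x = f x"
  shows "g summable_on A"
proof -
  have "(\<lambda>x. g x - f x) summable_on A"
    by (rule finite_nonzero_values_imp_summable_on, rule finite_subset[OF _ G]) (use eq in auto)
  from summable_on_add[OF f this] show ?thesis by simp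
qed

text \<open>Subtracting a function in the span of \<open>G\<close> changes only the coefficients on \<open>G\<close>, and the partial sum
  makes all of these vanish. Every series that occurs differs from that of \<open>v\<close> at finitely
  many indices; its convergence matters because \<open>infsum\<close> is 0 for divergent series.\<close>

lemma K_norm_Sop_le:
  assumes v: "v \<in> L2 m" "(\<lambda>ks. K_weight m \<beta> ks * (cmod (coef m v ks))\<^sup>2) summable_on index_set m"
    and G: "finite G" "G \<subseteq> index_set m" and g: "g \<in> Vspan m G"
  shows "K_norm m \<beta> (v - Sop m G v) \<le> K_norm m \<beta> (v - g)"
proof -
  obtain c where c: "g = Lcomb m G c" using Vspan_imp_Lcomb[OF G(1) g] by blast
  have coef: "coef m (v - Lcomb m G d) ks = coef m v ks - (if ks \<in> G then d ks else 0)"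
    if "ks \<in> index_set m" for ks d
    using that by (simp add: coef_diff[OF v(1) Lcomb_L2] coef_Lcomb[OF G])
  have summable: "(\<lambda>ks. K_weight m \<beta> ks * (cmod (coef m (v - Lcomb m G d) ks))\<^sup>2) summable_on index_set m" for d
    by (rule summable_on_finite_change[OF v(2) G(1)]) (simp add: coef)
  show ?thesis
    unfolding K_norm_eq Sop_eq_Lcomb c
    by (intro real_sqrt_le_mono infsum_mono summable mult_left_mono power_mono)
       (auto simp: coef K_weight_def)
qed

text \<open>The exchange lemma; it covers subspaces of a span that have no basis among the spanning functions.\<close>

lemma dim_at_most_subspace:
  assumes "cfun.subspace M" "M \<subseteq> cfun.span S" "finite S" "card S \<le> n"
  shows "dim_at_most n M"
proof -
  obtain B where B: "B \<subseteq> M" "\<not> cfun.dependent B" "M \<subseteq> cfun.span B"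
    using cfun.maximal_independent_subset[of M] by blast
  have "finite B \<and> card B \<le> card S"
    using B assms by (intro cfun.independent_span_bound) auto
  moreover have "cfun.span B = M"
    using B cfun.span_minimal[OF B(1) assms(1)] by auto
  ultimately show ?thesis unfolding dim_at_most_def using B(2) assms(4) by (intro exI[of _ B]) auto
qed

lemma kolmogorov_width_le:
  assumes "cfun.subspace M" "M \<subseteq> X" "dim_at_most n M"
  shows "kolmogorov_width n W X N \<le> (SUP w\<in>W. INF v\<in>M. ennreal (N (w - v)))"
  unfolding kolmogorov_width_def by (rule INF_lower) (use assms in auto)

definition depends_on_first :: "nat \<Rightarrow> nat \<Rightarrow> tifun \<Rightarrow> bool" where
  "depends_on_first m s w \<longleftrightarrow>
    (\<forall>x\<in>space (torus m). \<forall>y\<in>space cube. \<forall>y'\<in>space cube.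
      (\<forall>j<s. y j = y' j) \<longrightarrow> w (x, y) = w (x, y'))"

lemma L2_fin_iff:
  "v \<in> L2_fin m s \<longleftrightarrow>
    v \<in> L2 m \<and> (\<exists>w\<in>L2 m. (AE z in TI m. v z = w z) \<and> depends_on_first m s w)"
  by (simp add: L2_fin_def depends_on_first_def)

lemma L2_fin_subspace: "cfun.subspace (L2_fin m s)"
proof (rule cfun.subspaceI)
  have "(0 :: tifun) \<in> L2 m" by (rule cfun.subspace_0[OF L2_subspace])
  moreover have "depends_on_first m s 0" by (simp add: depends_on_first_def)
  ultimately show "0 \<in> L2_fin m s" unfolding L2_fin_iff by (intro conjI bexI[of _ 0]) auto
next
  fix u v assume u: "u \<in> L2_fin m s" and v: "v \<in> L2_fin m s"
  from u obtain u' where u': "u \<in> L2 m" "u' \<in> L2 m" "AE z in TI m. u z = u' z" "depends_on_first m s u'"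
    unfolding L2_fin_iff by blast
  from v obtain v' where v': "v \<in> L2 m" "v' \<in> L2 m" "AE z in TI m. v z = v' z" "depends_on_first m s v'"
    unfolding L2_fin_iff by blast
  have "AE z in TI m. (u + v) z = (u' + v') z" using u'(3) v'(3) by eventually_elim simp
  moreover have "depends_on_first m s (u' + v')"
    using u'(4) v'(4) unfolding depends_on_first_def plus_fun_apply by metis
  moreover have "u + v \<in> L2 m" "u' + v' \<in> L2 m"
    by (rule cfun.subspace_add[OF L2_subspace]; fact)+
  ultimately show "u + v \<in> L2_fin m s" unfolding L2_fin_iff by blast
next
  fix c v assume v: "v \<in> L2_fin m s"
  then obtain v' where v': "v \<in> L2 m" "v' \<in> L2 m" "AE z in TI m. v z = v' z" "depends_on_first m s v'"
    unfolding L2_fin_iff by blast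
  have "AE z in TI m. fun_scale c v z = fun_scale c v' z"
    using v'(3) by eventually_elim (simp add: fun_scale_def)
  moreover have "depends_on_first m s (fun_scale c v')"
    using v'(4) unfolding depends_on_first_def fun_scale_def by metis
  moreover have "fun_scale c v \<in> L2 m" "fun_scale c v' \<in> L2 m"
    by (rule cfun.subspace_scale[OF L2_subspace]; fact)+
  ultimately show "fun_scale c v \<in> L2_fin m s" unfolding L2_fin_iff by blast
qed

text \<open>The Legendre polynomial of positive degree in \<open>y\<^sub>j\<close> has mean 0, and no other factor of the integrand
  involves \<open>y\<^sub>j\<close>.\<close>

lemma coef_L2_fin_eq_0:
  assumes v: "v \<in> L2_fin m r" and s: "s \<in> Fseq" and j: "j \<in> supp s" "r \<le> j"
  shows "coef m v (k, s) = 0"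
proof -
  obtain w where vL2: "v \<in> L2 m" and w: "w \<in> L2 m" "AE z in TI m. v z = w z"
    and dep: "depends_on_first m r w"
    using v unfolding L2_fin_iff by blast
  have [measurable]: "v \<in> borel_measurable (TI m)" "w \<in> borel_measurable (TI m)"
    using vL2 w by (auto simp: L2_def)
  have fin: "finite (supp s)" using s by (simp add: Fseq_iff)
  let ?Q = "\<lambda>y. \<Prod>i\<in>supp s - {j}. poly (legendre (s i)) (y i)"
  let ?g = "\<lambda>t. complex_of_real (poly (legendre (s j)) t)"
  have mean0: "(LINT t|unif. ?g t) = 0"
    using legendre_orthonormal[of "s j" 0] j(1) by (simp add: supp_def legendre_0)
  have Lp: "Lpoly s y = ?Q y * poly (legendre (s j)) (y j)" for y
    unfolding Lpoly_def using fin j(1) by (simp add: prod.remove[of _ j] mult.commute)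
  have inner: "(LINT y|cube. w (x, y) * cnj (Lfun m (k, s) (x, y))) = 0"
    if x: "x \<in> space (torus m)" for x
  proof -
    let ?h = "\<lambda>y. w (x, y) * cnj (efun m k x) * of_real (?Q y)"
    have eq: "w (x, y) * cnj (Lfun m (k, s) (x, y)) = ?h y * ?g (y j)" for y
      by (simp add: Lfun_def Lp mult_ac)
    show ?thesis
    proof (cases "integrable cube (\<lambda>y. ?h y * ?g (y j))")
      case True
      have "(LINT y|cube. ?h y * ?g (y j)) = (LINT y|cube. ?h y) * (LINT t|unif. ?g t)"
      proof (rule cube_integral_split[OF True])
        fix y t assume yt: "y \<in> space cube" "t \<in> {-1..1::real}"
        have "w (x, y(j := t)) = w (x, y)"
        proof -
          have "y(j := t) \<in> space cube" using yt by (auto simp: space_cube)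
          moreover have "\<forall>i<r. (y(j := t)) i = y i" using j(2) by auto
          ultimately show ?thesis using dep x yt(1) unfolding depends_on_first_def by blast
        qed
        moreover have "?Q (y(j := t)) = ?Q y" by (intro prod.cong) auto
        ultimately show "?h (y(j := t)) = ?h y" by simp
      qed
      then show ?thesis unfolding eq mean0 by simp
    next
      case False
      \<comment> \<open>Fubini's theorem gives integrability only for almost every \<open>x\<close>; at the others the integral is 0 by convention.\<close>
      then show ?thesis unfolding eq by (rule not_integrable_integral_eq)
    qed
  qed
  have "coef m v (k, s) = coef m w (k, s)"
    unfolding coef_def
  proof (rule integral_cong_AE)
    show "AE z in TI m. v z * cnj (Lfun m (k, s) z) = w z * cnj (Lfun m (k, s) z)"
      using w(2) by eventually_elim simp
  qed measurable
  also have "\<dots> = (LINT x|torus m. (LINT y|cube. w (x, y) * cnj (Lfun m (k, s) (x, y))))"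
    using TI.integral_fst'[OF integrable_mult_Lfun[OF w(1), unfolded TI_def]]
    by (simp add: coef_def TI_def)
  also have "\<dots> = (LINT x|torus m. 0)"
    by (intro Bochner_Integration.integral_cong refl inner)
  finally show ?thesis by simp
qed

lemma Sop_L2_fin:
  assumes v: "v \<in> L2_fin m r" and G: "G \<subseteq> index_set m"
  shows "Sop m G v \<in> L2_fin m r"
proof -
  have L2: "Sop m G v \<in> L2 m" unfolding Sop_eq_Lcomb by (rule Lcomb_L2)
  have "Sop m G v (x, y) = Sop m G v (x, y')"
    if eq: "\<forall>j<r. y j = y' j" for x y y'
    unfolding Sop_def
  proof (rule sum.cong[OF refl])
    fix ks assume ks: "ks \<in> G"
    obtain k s where [simp]: "ks = (k, s)" by (cases ks)
    have s: "s \<in> Fseq" using ks G by auto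
    show "coef m v ks * Lfun m ks (x, y) = coef m v ks * Lfun m ks (x, y')"
    proof (cases "\<exists>j\<in>supp s. r \<le> j")
      case True
      then show ?thesis using coef_L2_fin_eq_0[OF v s] by auto
    next
      case False
      then have "Lpoly s y = Lpoly s y'"
        unfolding Lpoly_def using eq by (intro prod.cong refl) (auto simp: not_le)
      then show ?thesis by (simp add: Lfun_def)
    qed
  qed
  then have "depends_on_first m r (Sop m G v)" unfolding depends_on_first_def by blast
  then show ?thesis unfolding L2_fin_iff using L2 by (intro conjI bexI[OF _ L2]) auto
qed

section \<open>Cardinality of the index set and the width estimate\<close>

lemma knorm_ge_1:
  assumes "m \<ge> 1" "k \<in> Zstar m"
  shows "1 \<le> knorm m k"
proof -
  have "k 0 \<noteq> 0" using PiE_mem[OF assms(2)[unfolded Zstar_def], of 0] assms(1) by simp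
  moreover have "\<bar>k 0\<bar> \<le> knorm m k" unfolding knorm_def using assms by (intro Max_ge) auto
  ultimately show ?thesis by linarith
qed

lemma rho_eq:
  assumes "\<And>j. b j > 0"
  shows "rho m a b (k, s) = real_of_int (knorm m k) powr a / multinomial_term b s"
proof -
  have "spow_neg b s = 1 / spow b s"
    by (simp add: spow_neg_def spow_def power_int_minus inverse_eq_divide prod_dividef)
  then show ?thesis by (simp add: rho_def multinomial_term_def)
qed

lemma card_Zstar_ball_le:
  assumes "m \<ge> 1" and R: "0 \<le> R"
  shows "finite {k \<in> Zstar m. real_of_int (knorm m k) \<le> R}"
    and "real (card {k \<in> Zstar m. real_of_int (knorm m k) \<le> R}) \<le> (2 * R) ^ m"
proof -
  define N where "N = nat \<lfloor>R\<rfloor>"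
  let ?I = "{- int N..int N} - {0}"
  have sub: "{k \<in> Zstar m. real_of_int (knorm m k) \<le> R} \<subseteq> {..<m} \<rightarrow>\<^sub>E ?I"
  proof
    fix k assume "k \<in> {k \<in> Zstar m. real_of_int (knorm m k) \<le> R}"
    then have k: "k \<in> Zstar m" "knorm m k \<le> \<lfloor>R\<rfloor>" by (auto simp: le_floor_iff)
    have "\<bar>k j\<bar> \<le> int N" if "j < m" for j
    proof -
      have "\<bar>k j\<bar> \<le> knorm m k" unfolding knorm_def using that by (intro Max_ge) auto
      then show ?thesis using k(2) R by (simp add: N_def)
    qed
    then have "k j \<in> {- int N..int N}" if "j < m" for j
      using that by (meson abs_le_D1 abs_le_D2 atLeastAtMost_iff minus_le_iff)
    then show "k \<in> {..<m} \<rightarrow>\<^sub>E ?I" using k(1) unfolding Zstar_def by (auto simp: PiE_iff)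
  qed
  have fin: "finite ({..<m} \<rightarrow>\<^sub>E ?I)" by (intro finite_PiE) auto
  show "finite {k \<in> Zstar m. real_of_int (knorm m k) \<le> R}" by (rule finite_subset[OF sub fin])
  have "card {k \<in> Zstar m. real_of_int (knorm m k) \<le> R} \<le> card ({..<m} \<rightarrow>\<^sub>E ?I)"
    by (rule card_mono[OF fin sub])
  also have "\<dots> = (2 * N) ^ m" by (simp add: card_PiE card_Diff_subset nat_add_distrib nat_mult_distrib)
  finally have "real (card {k \<in> Zstar m. real_of_int (knorm m k) \<le> R}) \<le> real ((2 * N) ^ m)"
    by (rule of_nat_mono)
  also have "\<dots> \<le> (2 * R) ^ m"
    using R by (simp add: N_def power_mono)
  finally show "real (card {k \<in> Zstar m. real_of_int (knorm m k) \<le> R}) \<le> (2 * R) ^ m" .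
qed

text \<open>The bound is shown for every finite subset first, which yields finiteness and the estimate
  together. For a fixed \<open>s\<close> the condition on \<open>k\<close> is that its norm is at most \<open>R s\<close>.\<close>

lemma card_Eset_le:
  assumes m: "m \<ge> 1" and a: "a > 0" and b: "\<And>j. b j > 0" and T: "T > 0"
    and sm: "width_term m a b summable_on Fseq"
  shows "finite (Eset m a b T)"
    and "real (card (Eset m a b T)) \<le> 2 ^ m * T powr (real m / a) * (\<Sum>\<^sub>\<infinity>s\<in>Fseq. width_term m a b s)"
proof -
  let ?x = "multinomial_term b"
  let ?S = "\<Sum>\<^sub>\<infinity>s\<in>Fseq. width_term m a b s"
  have x: "?x s > 0" for s by (rule multinomial_term_pos[OF b])
  have w: "width_term m a b s = ?x s powr (real m / a)" for s
    by (simp add: width_term_def multinomial_term_def)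
  have bound: "real (card F) \<le> 2 ^ m * T powr (real m / a) * ?S"
    if F: "finite F" "F \<subseteq> Eset m a b T" for F
  proof -
    define R where "R = (\<lambda>s. (T * ?x s) powr (1 / a))"
    define Ks where "Ks = (\<lambda>s. {k \<in> Zstar m. real_of_int (knorm m k) \<le> R s})"
    have Ks: "finite (Ks s)" "real (card (Ks s)) \<le> (2 * R s) ^ m" for s
      unfolding Ks_def by (intro card_Zstar_ball_le m; simp add: R_def)+
    have "F \<subseteq> (\<Union>s\<in>snd ` F. Ks s \<times> {s})"
    proof
      fix ks assume ks: "ks \<in> F"
      obtain k s where [simp]: "ks = (k, s)" by (cases ks)
      have k: "k \<in> Zstar m" "real_of_int (knorm m k) powr a / ?x s \<le> T"
        using ks F(2) by (auto simp: Eset_def rho_eq[OF b])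
      then have "real_of_int (knorm m k) powr a \<le> T * ?x s" using x[of s] by (simp add: field_simps)
      then have "(real_of_int (knorm m k) powr a) powr (1 / a) \<le> R s"
        unfolding R_def using a by (intro powr_mono2) auto
      then have "real_of_int (knorm m k) \<le> R s"
        using a knorm_ge_1[OF m k(1)] by (simp add: powr_powr)
      then show "ks \<in> (\<Union>s\<in>snd ` F. Ks s \<times> {s})" using ks k(1) by (force simp: Ks_def)
    qed
    then have "card F \<le> card (\<Union>s\<in>snd ` F. Ks s \<times> {s})"
      using F(1) Ks(1) by (intro card_mono) auto
    also have "\<dots> \<le> (\<Sum>s\<in>snd ` F. card (Ks s \<times> {s}))" using F(1) by (intro card_UN_le) auto
    finally have "real (card F) \<le> (\<Sum>s\<in>snd ` F. real (card (Ks s)))"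
      by (simp add: card_cartesian_product flip: of_nat_sum)
    also have "\<dots> \<le> (\<Sum>s\<in>snd ` F. (2 * R s) ^ m)" by (intro sum_mono Ks)
    also have "\<dots> = (\<Sum>s\<in>snd ` F. 2 ^ m * T powr (real m / a) * width_term m a b s)"
    proof (intro sum.cong refl)
      fix s
      have "R s ^ m = (T * ?x s) powr (real m / a)"
        unfolding R_def using x[of s] T by (simp add: powr_realpow[symmetric] powr_powr)
      then show "(2 * R s) ^ m = 2 ^ m * T powr (real m / a) * width_term m a b s"
        by (simp add: power_mult_distrib powr_mult w)
    qed
    also have "\<dots> = 2 ^ m * T powr (real m / a) * (\<Sum>s\<in>snd ` F. width_term m a b s)"
      by (simp add: sum_distrib_left)
    also have "\<dots> \<le> 2 ^ m * T powr (real m / a) * ?S"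
      using F by (intro mult_left_mono finite_sum_le_infsum sm) (auto simp: w Eset_def)
    finally show ?thesis .
  qed
  have "card F \<le> nat \<lfloor>2 ^ m * T powr (real m / a) * ?S\<rfloor>"
    if "F \<subseteq> Eset m a b T" "finite F" for F
    using bound[OF that(2,1)] by (simp add: le_nat_floor)
  then show fin: "finite (Eset m a b T)" using finite_if_finite_subsets_card_bdd by blast
  show "real (card (Eset m a b T)) \<le> 2 ^ m * T powr (real m / a) * ?S"
    by (rule bound[OF fin order_refl])
qed

lemma Eset_nonempty:
  assumes "m \<ge> 1" "T \<ge> 1"
  shows "Eset m a b T \<noteq> {}"
proof -
  define k where "k = (\<lambda>j\<in>{..<m}. 1::int)"
  have "(\<lambda>j. \<bar>k j\<bar>) ` {..<m} = {1}"
  proof -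
    have "(\<lambda>j. \<bar>k j\<bar>) ` {..<m} = (\<lambda>_. 1) ` {..<m}" by (intro image_cong) (auto simp: k_def)
    then show ?thesis using assms(1) by (simp add: image_constant_conv lessThan_empty_iff)
  qed
  then have "knorm m k = 1" by (simp add: knorm_def)
  then have "(k, \<lambda>_. 0) \<in> Eset m a b T"
    using assms(2)
    by (simp add: Eset_def rho_def k_def Zstar_def Fseq_def supp_def sfact_def snorm1_def spow_neg_def)
  then show ?thesis by blast
qed

text \<open>The parameters \<open>\<alpha>\<close> and \<open>\<alpha> - \<beta>\<close> of \<open>rho\<close> differ by the factor \<open>knorm m k powr \<beta>\<close>, the square
  root of the weight of \<open>K\<close>.\<close>

lemma K_weight_le_rho:
  assumes m: "m \<ge> 1" and b: "\<And>j. b j > 0" and T: "T > 0"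
    and ks: "ks \<in> index_set m" "ks \<notin> Eset m (\<alpha> - \<beta>) b T"
  shows "K_weight m \<beta> ks \<le> (1 / T)\<^sup>2 * (rho m \<alpha> b ks)\<^sup>2"
proof -
  obtain k s where [simp]: "ks = (k, s)" by (cases ks)
  define N where "N = real_of_int (knorm m k)"
  have N: "N \<ge> 1" using knorm_ge_1[OF m, of k] ks(1) by (auto simp: N_def)
  have r: "T \<le> rho m (\<alpha> - \<beta>) b ks" using ks by (auto simp: Eset_def)
  have "rho m \<alpha> b ks = N powr \<beta> * rho m (\<alpha> - \<beta>) b ks"
    using N by (simp add: rho_eq[OF b] N_def[symmetric] powr_diff)
  then have "T * N powr \<beta> \<le> rho m \<alpha> b ks" using mult_right_mono[OF r, of "N powr \<beta>"] by (simp add: mult.commute)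
  then have "(T * N powr \<beta>)\<^sup>2 \<le> (rho m \<alpha> b ks)\<^sup>2" using T by (intro power_mono) auto
  moreover have "K_weight m \<beta> ks = (N powr \<beta>)\<^sup>2"
    using N by (simp add: K_weight_def N_def[symmetric] powr_power)
  ultimately show ?thesis using T by (simp add: power_mult_distrib power_divide field_simps)
qed

lemma K_norm_remainder_le:
  assumes m: "m \<ge> 1" and b: "\<And>j. b j > 0" and T: "T > 0"
    and fin: "finite (Eset m (\<alpha> - \<beta>) b T)" and v: "v \<in> U_ball m \<alpha> b"
  shows "(\<lambda>ks. K_weight m \<beta> ks * (cmod (coef m v ks))\<^sup>2) summable_on index_set m"
    and "K_norm m \<beta> (v - Sop m (Eset m (\<alpha> - \<beta>) b T) v) \<le> 1 / T"
proof -
  let ?E = "Eset m (\<alpha> - \<beta>) b T"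
  let ?A = "\<lambda>ks. (rho m \<alpha> b ks)\<^sup>2 * (cmod (coef m v ks))\<^sup>2"
  have L2: "v \<in> L2 m" and A: "?A summable_on index_set m" and A1: "A_norm m \<alpha> b v \<le> 1"
    using v by (auto simp: U_ball_def A_space_def)
  have E: "?E \<subseteq> index_set m" by (auto simp: Eset_def)
  have coef: "coef m (v - Sop m ?E v) ks = (if ks \<in> ?E then 0 else coef m v ks)"
    if "ks \<in> index_set m" for ks
    using that by (simp add: Sop_eq_Lcomb coef_diff[OF L2 Lcomb_L2] coef_Lcomb[OF fin E])
  have le: "K_weight m \<beta> ks * (cmod (coef m (v - Sop m ?E v) ks))\<^sup>2 \<le> (1 / T)\<^sup>2 * ?A ks"
    if ks: "ks \<in> index_set m" for ks
  proof (cases "ks \<in> ?E")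
    case False
    have "K_weight m \<beta> ks * (cmod (coef m v ks))\<^sup>2 \<le> ((1 / T)\<^sup>2 * (rho m \<alpha> b ks)\<^sup>2) * (cmod (coef m v ks))\<^sup>2"
      by (intro mult_right_mono K_weight_le_rho m b T ks False) auto
    then show ?thesis using False ks by (simp add: coef mult.assoc)
  qed (use ks in \<open>simp add: coef\<close>)
  have A': "(\<lambda>ks. (1 / T)\<^sup>2 * ?A ks) summable_on index_set m" by (rule summable_on_cmult_right[OF A])
  have sum': "(\<lambda>ks. K_weight m \<beta> ks * (cmod (coef m (v - Sop m ?E v) ks))\<^sup>2) summable_on index_set m"
    by (rule summable_on_comparison_test[OF A']) (use le in \<open>auto simp: K_weight_def\<close>)
  show "(\<lambda>ks. K_weight m \<beta> ks * (cmod (coef m v ks))\<^sup>2) summable_on index_set m"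
    by (rule summable_on_finite_change[OF sum' fin]) (simp add: coef)
  have "(\<Sum>\<^sub>\<infinity>ks\<in>index_set m. K_weight m \<beta> ks * (cmod (coef m (v - Sop m ?E v) ks))\<^sup>2)
      \<le> (\<Sum>\<^sub>\<infinity>ks\<in>index_set m. (1 / T)\<^sup>2 * ?A ks)"
    by (rule infsum_mono[OF sum' A' le])
  also have "\<dots> = (1 / T)\<^sup>2 * (\<Sum>\<^sub>\<infinity>ks\<in>index_set m. ?A ks)"
    by (rule infsum_cmult_right[OF A])
  also have "\<dots> \<le> (1 / T)\<^sup>2 * 1"
    using A1 by (intro mult_left_mono) (auto simp: A_norm_def)
  finally have "K_norm m \<beta> (v - Sop m ?E v) \<le> sqrt ((1 / T)\<^sup>2)"
    unfolding K_norm_eq by (intro real_sqrt_le_mono) simp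
  then show "K_norm m \<beta> (v - Sop m ?E v) \<le> 1 / T" using T by simp
qed

lemma width_term_summable:
  assumes a: "a > 0" and m: "m \<ge> 1" and b: "\<And>j. b j > 0"
    and sub: "real m / a \<le> 1 \<Longrightarrow> summable b \<and> suminf b < 1 \<and> summable (\<lambda>j. b j powr (real m / a))"
    and sup: "real m / a > 1 \<Longrightarrow> summable b \<and> suminf b \<le> 1"
  shows "width_term m a b summable_on Fseq"
proof -
  have "width_term m a b = (\<lambda>s. multinomial_term b s powr (real m / a))"
    by (simp add: fun_eq_iff width_term_def multinomial_term_def)
  moreover have "0 < real m / a" using a m by simp
  ultimately show ?thesis
    using multinomial_term_summable_subcritical[of b "real m / a"]
      multinomial_term_summable_supercritical[of b "real m / a"] b sub sup
    by (cases "real m / a \<le> 1") (auto simp: less_imp_le not_le)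
qed

text \<open>The bound of \<open>card_Eset_le\<close> solved for \<open>1 / T\<close>. This needs the set to be nonempty: for
  cardinality 0 the negative power on the right would be 0.\<close>

lemma radius_le_card_power:
  assumes m: "m \<ge> 1" and a: "a > 0" and b: "\<And>j. b j > 0" and T: "T \<ge> 1"
    and sm: "width_term m a b summable_on Fseq"
  shows "1 / T \<le> 2 powr a * width_const m a b powr (a / real m)
    * real (card (Eset m a b T)) powr (- a / real m)"
proof -
  let ?n = "real (card (Eset m a b T))"
  define S where "S = (\<Sum>\<^sub>\<infinity>s\<in>Fseq. width_term m a b s)"
  have S0: "S \<ge> 0" unfolding S_def by (intro infsum_nonneg) (simp add: width_term_def)
  have C: "S \<le> width_const m a b"
    unfolding width_const_def S_def[symmetric]
    using mult_right_mono[OF one_le_power[of "3 / 2 :: real" "2 * m"] S0] by simp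
  have n: "?n > 0"
    using card_Eset_le(1)[OF m a b _ sm, of T] Eset_nonempty[OF m T, of a b] T
    by (simp add: card_gt_0_iff)
  have "?n \<le> 2 ^ m * T powr (real m / a) * S"
    unfolding S_def using T by (intro card_Eset_le m a b sm) auto
  also have "\<dots> \<le> 2 ^ m * T powr (real m / a) * width_const m a b"
    using C by (intro mult_left_mono) auto
  finally have "?n powr (a / real m) \<le> (2 ^ m * T powr (real m / a) * width_const m a b) powr (a / real m)"
    using a by (intro powr_mono2) auto
  also have "\<dots> = 2 powr a * T * width_const m a b powr (a / real m)"
    using a m T by (simp add: powr_mult powr_powr powr_realpow[symmetric])
  finally have "?n powr (a / real m) \<le> T * (2 powr a * width_const m a b powr (a / real m))"
    by (simp add: mult_ac)
  then show ?thesis using n T by (simp add: powr_minus field_simps)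
qed

theorem theorem6p2:
  fixes m :: nat and \<alpha> \<beta> T :: real and b :: "nat \<Rightarrow> real"
  defines "a \<equiv> \<alpha> - \<beta>"
  defines "E \<equiv> Eset m a b T"
  defines "n \<equiv> card E"
  defines "C \<equiv> width_const m a b"
  assumes "m \<ge> 1" and "0 \<le> \<beta>" and "\<beta> < \<alpha>" and "\<And>j. b j > 0"
    and "real m / a \<le> 1 \<Longrightarrow>
      summable b \<and> suminf b < 1 \<and> summable (\<lambda>j. b j powr (real m / a))"
    and "real m / a > 1 \<Longrightarrow> summable b \<and> suminf b \<le> 1"
    and "T \<ge> 1"
  shows "finite E \<and> width_term m a b summable_on Fseq \<and>
    kolmogorov_width n (U_ball m \<alpha> b) (K_space m \<beta>) (K_norm m \<beta>)
      \<le> (SUP v \<in> U_ball m \<alpha> b. INF g \<in> Vspan m E. ennreal (K_norm m \<beta> (v - g))) \<and>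
    (SUP v \<in> U_ball m \<alpha> b. INF g \<in> Vspan m E. ennreal (K_norm m \<beta> (v - g)))
      = (SUP v \<in> U_ball m \<alpha> b. ennreal (K_norm m \<beta> (v - Sop m E v))) \<and>
    (SUP v \<in> U_ball m \<alpha> b. ennreal (K_norm m \<beta> (v - Sop m E v)))
      \<le> ennreal (2 powr a * C powr (a / real m) * real n powr (- a / real m)) \<and>
    (\<forall>s\<ge>1.
      kolmogorov_width n (U_ball_fin m \<alpha> b s) (K_space_fin m \<beta> s) (K_norm m \<beta>)
        \<le> (SUP v \<in> U_ball_fin m \<alpha> b s. INF g \<in> Vspan_fin m E s. ennreal (K_norm m \<beta> (v - g))) \<and>
      (SUP v \<in> U_ball_fin m \<alpha> b s. INF g \<in> Vspan_fin m E s. ennreal (K_norm m \<beta> (v - g)))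
        = (SUP v \<in> U_ball_fin m \<alpha> b s. ennreal (K_norm m \<beta> (v - Sop m E v))) \<and>
      (SUP v \<in> U_ball_fin m \<alpha> b s. ennreal (K_norm m \<beta> (v - Sop m E v)))
        \<le> ennreal (2 powr a * C powr (a / real m) * real n powr (- a / real m)))"
proof -
  note m = assms(5) and \<alpha>\<beta> = assms(7) and b = assms(8) and T = assms(11)
  have a: "a > 0" using \<alpha>\<beta> by (simp add: a_def)
  have T0: "T > 0" using T by simp
  have sm: "width_term m a b summable_on Fseq"
    by (rule width_term_summable[OF a m b assms(9,10)])
  have fin: "finite E"
    unfolding E_def using T by (intro card_Eset_le(1) m a b sm) auto
  have sub: "E \<subseteq> index_set m" by (auto simp: E_def Eset_def)
  let ?bound = "2 powr a * C powr (a / real m) * real n powr (- a / real m)"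
  have remainder: "K_norm m \<beta> (v - Sop m E v) \<le> ?bound" if "v \<in> U_ball m \<alpha> b" for v
  proof -
    have "K_norm m \<beta> (v - Sop m E v) \<le> 1 / T"
      using K_norm_remainder_le(2)[OF m b T0 _ that] fin by (simp add: E_def a_def)
    also have "\<dots> \<le> ?bound"
      unfolding n_def E_def C_def by (rule radius_le_card_power[OF m a b T sm])
    finally show ?thesis .
  qed
  have best: "K_norm m \<beta> (v - Sop m E v) \<le> K_norm m \<beta> (v - g)"
    if v: "v \<in> U_ball m \<alpha> b" and g: "g \<in> Vspan m E" for v g
  proof (rule K_norm_Sop_le[OF _ _ fin sub g])
    show "v \<in> L2 m" using v by (simp add: U_ball_def A_space_def)
    show "(\<lambda>ks. K_weight m \<beta> ks * (cmod (coef m v ks))\<^sup>2) summable_on index_set m"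
      using K_norm_remainder_le(1)[OF m b T0 _ v] fin by (simp add: E_def a_def)
  qed
  have inf_eq: "(INF g \<in> M. ennreal (K_norm m \<beta> (v - g))) = ennreal (K_norm m \<beta> (v - Sop m E v))"
    if "v \<in> U_ball m \<alpha> b" "M \<subseteq> Vspan m E" "Sop m E v \<in> M" for v M
    using that best by (intro antisym INF_lower INF_greatest ennreal_leI) auto
  have width: "kolmogorov_width n W X (K_norm m \<beta>) \<le> (SUP w\<in>W. INF v\<in>M. ennreal (K_norm m \<beta> (w - v)))"
    if "cfun.subspace M" "M \<subseteq> Vspan m E" "M \<subseteq> X" for W X M
  proof (rule kolmogorov_width_le[OF that(1,3)])
    show "dim_at_most n M"
      using that(2) fin card_image_le[OF fin]
      by (intro dim_at_most_subspace[OF that(1), of "Lfun m ` E"]) (auto simp: Vspan_def n_def)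
  qed
  have K: "Vspan m E \<subseteq> K_space m \<beta>" by (rule Vspan_subset_K_space[OF fin sub])
  have sspan: "cfun.subspace (Vspan m E)" by (simp add: Vspan_def)
  have Sop: "Sop m E v \<in> Vspan m E" for v unfolding Sop_eq_Lcomb by (rule Lcomb_in_Vspan)
  \<comment> \<open>Both parts of the theorem are instances: \<open>M\<close> is the span of the index set, or the subspace of its functions of finitely many variables.\<close>
  have all: "kolmogorov_width n U X (K_norm m \<beta>) \<le> (SUP v \<in> U. INF g \<in> M. ennreal (K_norm m \<beta> (v - g))) \<and>
      (SUP v \<in> U. INF g \<in> M. ennreal (K_norm m \<beta> (v - g))) = (SUP v \<in> U. ennreal (K_norm m \<beta> (v - Sop m E v))) \<and>
      (SUP v \<in> U. ennreal (K_norm m \<beta> (v - Sop m E v))) \<le> ennreal ?bound"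
    if M: "cfun.subspace M" "M \<subseteq> Vspan m E" "M \<subseteq> X"
      and U: "U \<subseteq> U_ball m \<alpha> b" "\<And>v. v \<in> U \<Longrightarrow> Sop m E v \<in> M" for U X M
  proof (intro conjI)
    show "kolmogorov_width n U X (K_norm m \<beta>) \<le> (SUP v \<in> U. INF g \<in> M. ennreal (K_norm m \<beta> (v - g)))"
      by (rule width[OF M])
    show "(SUP v \<in> U. INF g \<in> M. ennreal (K_norm m \<beta> (v - g))) = (SUP v \<in> U. ennreal (K_norm m \<beta> (v - Sop m E v)))"
      using U M(2) by (intro SUP_cong refl inf_eq) auto
    show "(SUP v \<in> U. ennreal (K_norm m \<beta> (v - Sop m E v))) \<le> ennreal ?bound"
      using U(1) by (intro SUP_least ennreal_leI remainder) auto
  qed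
  have "cfun.subspace (Vspan_fin m E s)" for s
    unfolding Vspan_fin_def by (intro cfun.subspace_inter sspan L2_fin_subspace)
  then have "kolmogorov_width n (U_ball_fin m \<alpha> b s) (K_space_fin m \<beta> s) (K_norm m \<beta>)
        \<le> (SUP v \<in> U_ball_fin m \<alpha> b s. INF g \<in> Vspan_fin m E s. ennreal (K_norm m \<beta> (v - g))) \<and>
      (SUP v \<in> U_ball_fin m \<alpha> b s. INF g \<in> Vspan_fin m E s. ennreal (K_norm m \<beta> (v - g)))
        = (SUP v \<in> U_ball_fin m \<alpha> b s. ennreal (K_norm m \<beta> (v - Sop m E v))) \<and>
      (SUP v \<in> U_ball_fin m \<alpha> b s. ennreal (K_norm m \<beta> (v - Sop m E v))) \<le> ennreal ?bound" for s
    using K Sop Sop_L2_fin[OF _ sub]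
    by (intro all) (auto simp: Vspan_fin_def K_space_fin_def U_ball_fin_def U_ball_def A_space_fin_def)
  moreover note all[OF sspan order_refl K order_refl Sop]
  ultimately show ?thesis using fin sm by blast
qed

end
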